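(* Let $\psi\colon\mathcal{P}(\mathbb{R}^d)\times\hat{\mathscr{B}}(\mathbb{R}^d)\to\mathbb{R}$ be such that for all $C,D\in\mathcal{P}(\mathbb{R}^d)$, $M\in\hat{\mathscr{B}}(\mathbb{R}^d)$, $Q\in O(d)$: (0) $\psi(C,\cdot)$ is a conic measure; (1) $\psi(C,M)=\psi(C,M\cap C)$; (2) $\psi(QC,QM)=\psi(C,M)$; (3) $\psi(C,M)=\psi(D,M)$ if $S_k(C)\cap M=S_k(D)\cap M$ for all $k=0,\ldots,d$. Then $\psi$ is a linear combination of $\mathrm{Lin}_d,\ldots,\mathrm{Lin}_1,\mathrm{Lin}_0=\Psi_0,\Psi_1,\ldots,\Psi_d$. In this case $$\psi = \sum_{k=0}^d \psi(L^{(k)},\{0\})\,\mathrm{Lin}_k + \sum_{k=1}^d \psi(L^{(k)},\mathbb{R}^d_* )\,\Psi_k ,$$ where $L^{(k)}\subseteq\mathbb{R}^d$ denotes a $k$-dimensional linear subspace.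
   Context: A polyhedral cone in $\mathbb{R}^d$ is a set of the form $\{x\in\mathbb{R}^d : Ax\le 0\}$ for some real matrix $A$ with $d$ columns; $\mathcal{P}(\mathbb{R}^d)$ is the set of polyhedral cones in $\mathbb{R}^d$. A face of $C$ is a subset $\{x\in C: \langle x,z\rangle=0\}$, where $z\in\mathbb{R}^d$ satisfies $\langle x,z\rangle\le 0$ for all $x\in C$. $\mathcal{L}_k(C)$ is the finite set of linear spans of faces of $C$ whose span has dimension $k$. The $k$-skeleton of $C$ is the disjoint union $S_k(C)=\bigcup_{L\in\mathcal{L}_k(C)}\mathrm{int}_L(C\cap L)$, where $\mathrm{int}_L$ is the interior relative to $L$. $\hat{\mathscr{B}}(\mathbb{R}^d)$ is the conic $\sigma$-algebra: the Borel sets $M\subseteq\mathbb{R}^d$ with $\lambda M=M$ for all $\lambda>0$. A conic measure is a $\sigma$-additive real-valued function on $\hat{\mathscr{B}}(\mathbb{R}^d)$. $\mathbb{R}^d_*=\mathbb{R}^d\setminus\{0\}$. $\gamma_L$ is the standard Gaussian measure on a linear subspace $L$ (the Dirac measure at the origin if $\dim L=0$). The polyhedral measures are $\Psi_k(C,M)=\sum_{L\in\mathcal{L}_k(C)}\gamma_L(C\cap L\cap M)$. The lineality measures are $\mathrm{Lin}_k(C,M)=1$ if $\dim(C\cap(-C))=k$ and $0\in M$, and $\mathrm{Lin}_k(C,M)=0$ otherwise ($0\le k\le d$). *)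

theory Defs
  imports "HOL-Probability.Probability"
begin

(* The rows of the matrix A are A 0, ..., A (m - 1). *)
definition polyhedral_cones :: "(real ^ 'n) set set" where
  "polyhedral_cones = {C. \<exists>(m::nat) (A :: nat \<Rightarrow> real ^ 'n). C = {x. \<forall>i<m. A i \<bullet> x \<le> 0}}"

definition cone_faces :: "(real ^ 'n) set \<Rightarrow> (real ^ 'n) set set" where
  "cone_faces C = {F. \<exists>z. (\<forall>x\<in>C. x \<bullet> z \<le> 0) \<and> F = {x \<in> C. x \<bullet> z = 0}}"

definition face_spans :: "nat \<Rightarrow> (real ^ 'n) set \<Rightarrow> (real ^ 'n) set set" where
  "face_spans k C = {L. \<exists>F\<in>cone_faces C. L = span F \<and> dim L = k}"

definition skeleton :: "nat \<Rightarrow> (real ^ 'n) set \<Rightarrow> (real ^ 'n) set" where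
  "skeleton k C = (\<Union>L\<in>face_spans k C. (top_of_set L) interior_of (C \<inter> L))"

definition conic_sets :: "(real ^ 'n) set set" where
  "conic_sets = {M \<in> sets borel. \<forall>c::real. c > 0 \<longrightarrow> (\<lambda>x. c *\<^sub>R x) ` M = M}"

(* Signed; the value at the empty set is forced to be 0 by convergence of the constant series. *)
definition conic_measure :: "((real ^ 'n) set \<Rightarrow> real) \<Rightarrow> bool" where
  "conic_measure \<mu> \<longleftrightarrow>
     (\<forall>M :: nat \<Rightarrow> (real ^ 'n) set. range M \<subseteq> conic_sets \<longrightarrow> disjoint_family M \<longrightarrow>
        (\<lambda>i. \<mu> (M i)) sums \<mu> (\<Union>i. M i))"

(* The law of the sum of g b *\<^sub>R b over an orthonormal basis B of L, with independent standard
   normal coefficients g b; by rotation invariance it does not depend on the basis that is chosen.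
   It is a measure on the ambient space, concentrated on L. If L = {0}, then B is empty and this
   is the Dirac measure at the origin. *)
definition subspace_gaussian :: "(real ^ 'n) set \<Rightarrow> (real ^ 'n) measure" where
  "subspace_gaussian L =
     (let B = (SOME B. pairwise orthogonal B \<and> (\<forall>b\<in>B. norm b = 1) \<and> span B = L)
      in distr (\<Pi>\<^sub>M b\<in>B. density lborel (\<lambda>t. ennreal (std_normal_density t))) borel
           (\<lambda>g. \<Sum>b\<in>B. g b *\<^sub>R b))"

definition polyhedral_measure :: "nat \<Rightarrow> (real ^ 'n) set \<Rightarrow> (real ^ 'n) set \<Rightarrow> real" where
  "polyhedral_measure k C M = (\<Sum>L\<in>face_spans k C. measure (subspace_gaussian L) (C \<inter> L \<inter> M))"

definition lineality_measure :: "nat \<Rightarrow> (real ^ 'n) set \<Rightarrow> (real ^ 'n) set \<Rightarrow> real" where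
  "lineality_measure k C M = (if dim (C \<inter> uminus ` C) = k \<and> 0 \<in> M then 1 else 0)"

lemma finite_face_spans:
  fixes C :: "(real ^ 'n) set"
  assumes "C \<in> polyhedral_cones"
  shows "finite (face_spans k C)"
proof -
  obtain m :: nat and A :: "nat \<Rightarrow> real ^ 'n" where C: "C = {x. \<forall>i<m. A i \<bullet> x \<le> 0}"
    using assms unfolding polyhedral_cones_def by blast
  have "C = \<Inter> ((\<lambda>i. {x. A i \<bullet> x \<le> 0}) ` {..<m})"
    using C by auto
  then have P: "polyhedron C"
    by (auto intro!: polyhedron_Inter polyhedron_halfspace_le)
  then have cv: "convex C"
    by (rule polyhedron_imp_convex)
  have "cone_faces C \<subseteq> {F. F face_of C}"
  proof
    fix F assume "F \<in> cone_faces C"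
    then obtain z where z: "\<And>x. x \<in> C \<Longrightarrow> z \<bullet> x \<le> 0" "F = C \<inter> {x. z \<bullet> x = 0}"
      unfolding cone_faces_def by (auto simp: inner_commute)
    then show "F \<in> {F. F face_of C}"
      using face_of_Int_supporting_hyperplane_le[OF cv, of z 0] by simp
  qed
  then have "finite (cone_faces C)"
    using finite_polyhedron_faces[OF P] finite_subset by blast
  moreover have "face_spans k C \<subseteq> span ` cone_faces C"
    unfolding face_spans_def by auto
  ultimately show ?thesis
    using finite_surj by blast
qed

lemma subspace_gaussian_eq:
  fixes L :: "(real ^ 'n) set"
  assumes "subspace L"
  shows "\<exists>B. pairwise orthogonal B \<and> (\<forall>b\<in>B. norm b = 1) \<and> span B = L \<and> finite B \<and>
    subspace_gaussian L =
      distr (\<Pi>\<^sub>M b\<in>B. density lborel (\<lambda>t. ennreal (std_normal_density t))) borel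
        (\<lambda>g. \<Sum>b\<in>B. g b *\<^sub>R b)"
proof -
  let ?P = "\<lambda>B. pairwise orthogonal B \<and> (\<forall>b\<in>B. norm b = 1) \<and> span B = L"
  obtain B0 where "?P B0"
    using orthonormal_basis_subspace[OF assms] by metis
  then have P: "?P (SOME B. ?P B)"
    by (rule someI)
  then have "0 \<notin> (SOME B. ?P B)"
    by force
  then have "finite (SOME B. ?P B)"
    using P pairwise_orthogonal_independent independent_imp_finite by blast
  with P show ?thesis
    unfolding subspace_gaussian_def Let_def by blast
qed

end

theory Submission imports Defs begin

text \<open>
Two observations reduce the theorem to linear subspaces. The first is pointwise: for a polyhedral cone
\<open>C\<close> and \<open>x \<in> C\<close> let \<open>tangent_lineality C x\<close> be the space of directions in which a short segment
centred at \<open>x\<close> stays in \<open>C\<close>. It is the span of the smallest face that contains \<open>x\<close>, so the \<open>k\<close>-skeleton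
consists of the points where its dimension is \<open>k\<close>, and the relatively open face with span \<open>L\<close> is the
set of points where it equals \<open>L\<close> (\<open>relative_interior_face_span\<close>, \<open>skeleton_eq\<close>). Hence the skeleta of
\<open>C\<close> cannot be told apart from those of the subspace \<open>L\<close> inside this open face, nor from those of the
lineality space of \<open>C\<close> at the origin, and the locality of \<open>\<psi>\<close> in its first argument replaces \<open>C\<close> by a
subspace in both places. The second is that \<open>C\<close> is the disjoint union of its finitely many relatively
open faces, so that additivity recovers \<open>\<psi> C M\<close> from \<open>M \<inter> {0}\<close> and the parts of \<open>M - {0}\<close> in the
faces. The origin produces the lineality measures.

For a subspace \<open>L\<close> of positive dimension, \<open>\<psi> L\<close> restricted to conic sets that miss the origin is a signed
measure on the directions in \<open>L\<close> which is invariant under all rotations of \<open>L\<close>. It must be a multiple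
of the distribution of directions of the Gaussian measure (\<open>invariant_conic_measure\<close>); since the
complement of the open face in \<open>C \<inter> L\<close> is a Gaussian null set, the polyhedral measures appear.

Uniqueness of an invariant measure on the sphere is shown without Haar measure. The positive and negative
parts of the signed measure, taken as suprema over subsets, inherit its invariance. An invariant finite
measure gives the same mass to all balls of radius \<open>r\<close> centred on the sphere, and two measures whose
balls have proportional masses are proportional: count in two ways the pairs of points at distance less
than \<open>r\<close>, one distributed according to each measure, and let \<open>r\<close> tend to 0
(\<open>uniformly_distributed_unique\<close>). The same principle, applied to Lebesgue measure and its image under an
orthogonal map, yields the rotation invariance of the standard Gaussian measure, and projecting it
orthogonally gives that of \<open>subspace_gaussian L\<close>.
\<close>

section \<open>Signed measures and their upper variation\<close>

text \<open>Convergence of the constant series at the empty set forces the value 0 there.\<close>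

definition countably_additive_signed :: "'a measure \<Rightarrow> ('a set \<Rightarrow> real) \<Rightarrow> bool" where
  "countably_additive_signed M \<nu> \<longleftrightarrow>
     (\<forall>A :: nat \<Rightarrow> 'a set. range A \<subseteq> sets M \<longrightarrow> disjoint_family A \<longrightarrow>
        (\<lambda>i. \<nu> (A i)) sums \<nu> (\<Union>i. A i))"

text \<open>The positive part in the Jordan decomposition. As a supremum over subsets it depends on no choice of a
Hahn decomposition, so every symmetry of \<open>\<nu>\<close> passes to it.\<close>

definition upper_variation :: "'a measure \<Rightarrow> ('a set \<Rightarrow> real) \<Rightarrow> 'a set \<Rightarrow> real" where
  "upper_variation M \<nu> A = (SUP B\<in>{B \<in> sets M. B \<subseteq> A}. \<nu> B)"

lemma signed_empty:
  assumes "countably_additive_signed M \<nu>"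
  shows "\<nu> {} = 0"
proof -
  have "(\<lambda>i::nat. \<nu> {}) sums \<nu> (\<Union>i::nat. {})"
    using assms[unfolded countably_additive_signed_def, rule_format, of "\<lambda>_. {}"]
    by (simp add: disjoint_family_on_def image_subset_iff)
  then have "summable (\<lambda>i::nat. \<nu> {})" by (rule sums_summable)
  then have "(\<lambda>i::nat. \<nu> {}) \<longlonglongrightarrow> 0" by (rule summable_LIMSEQ_zero)
  then show ?thesis by (simp add: LIMSEQ_const_iff)
qed

lemma signed_Un:
  assumes \<nu>: "countably_additive_signed M \<nu>" and "A \<in> sets M" "B \<in> sets M" "A \<inter> B = {}"
  shows "\<nu> (A \<union> B) = \<nu> A + \<nu> B"
proof -
  have "range (binaryset A B) \<subseteq> sets M" "disjoint_family (binaryset A B)"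
    using assms by (auto simp: range_binaryset_eq disjoint_family_on_def binaryset_def)
  then have "(\<lambda>i. \<nu> (binaryset A B i)) sums \<nu> (A \<union> B)"
    using \<nu> UN_binaryset_eq[of A B] unfolding countably_additive_signed_def by metis
  moreover have "(\<lambda>i. \<nu> (binaryset A B i)) sums (\<nu> A + \<nu> B)"
    using binaryset_sums[of \<nu> A B] signed_empty[OF \<nu>] by simp
  ultimately show ?thesis by (rule sums_unique2)
qed

lemma signed_Diff:
  assumes "countably_additive_signed M \<nu>" "A \<in> sets M" "B \<in> sets M" "B \<subseteq> A"
  shows "\<nu> (A - B) = \<nu> A - \<nu> B"
proof -
  have "B \<union> (A - B) = A" using assms by auto
  then show ?thesis using signed_Un[of M \<nu> B "A - B"] assms by auto
qed

lemma signed_finite_UN: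
  assumes \<nu>: "countably_additive_signed M \<nu>" and "finite I"
    and "\<And>i. i \<in> I \<Longrightarrow> A i \<in> sets M" "disjoint_family_on A I"
  shows "\<nu> (\<Union>i\<in>I. A i) = (\<Sum>i\<in>I. \<nu> (A i))"
  using assms(2-)
proof (induction I)
  case empty
  then show ?case using signed_empty[OF \<nu>] by simp
next
  case (insert i I)
  have "\<nu> (A i \<union> (\<Union>i\<in>I. A i)) = \<nu> (A i) + \<nu> (\<Union>i\<in>I. A i)"
  proof (rule signed_Un[OF \<nu>])
    show "A i \<inter> (\<Union>i\<in>I. A i) = {}"
      using insert.prems(2) insert.hyps(2) by (auto simp: disjoint_family_on_def)
  qed (use insert.prems insert.hyps in auto)
  moreover have "disjoint_family_on A I"
    using insert.prems(2) by (rule disjoint_family_on_mono[rotated]) auto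
  ultimately show ?case using insert by simp
qed

text \<open>Exhaustion: if \<open>\<nu>\<close> is unbounded on the measurable subsets of \<open>A\<close>, then \<open>A\<close> splits into two parts on
which \<open>\<bar>\<nu>\<bar>\<close> exceeds 1, and on the subsets of one of them \<open>\<nu>\<close> is unbounded again. Cutting off the
other part again and again yields disjoint sets whose values do not tend to 0, which countable additivity
rules out.\<close>

lemma signed_bounded:
  assumes \<nu>: "countably_additive_signed M \<nu>"
  obtains K where "\<And>A. A \<in> sets M \<Longrightarrow> \<nu> A \<le> K"
proof (rule ccontr)
  define U where "U A \<longleftrightarrow> A \<in> sets M \<and> (\<forall>K. \<exists>B\<in>sets M. B \<subseteq> A \<and> K < \<bar>\<nu> B\<bar>)" for A
  have UD: "\<exists>B\<in>sets M. B \<subseteq> A \<and> K < \<bar>\<nu> B\<bar>" if "U A" for A K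
    using that by (simp add: U_def)
  assume "\<not> thesis"
  then have "\<forall>K. \<exists>B\<in>sets M. K < \<nu> B"
    using that by (meson not_le)
  then have U0: "U (space M)"
    unfolding U_def by (metis abs_ge_self order_less_le_trans sets.sets_into_space sets.top)
  \<comment> \<open>\<open>U A\<close>: the values on measurable subsets of \<open>A\<close> are unbounded. The margin 1 below bounds
    both \<open>\<bar>\<nu> E\<bar>\<close> and \<open>\<bar>\<nu> (A - E)\<bar>\<close> away from 0.\<close>
  have step: "\<exists>B. U B \<and> B \<subseteq> A \<and> 1 < \<bar>\<nu> (A - B)\<bar>" if UA: "U A" for A
  proof -
    have A: "A \<in> sets M" using that by (simp add: U_def)
    obtain E where E: "E \<in> sets M" "E \<subseteq> A" "\<bar>\<nu> A\<bar> + 1 < \<bar>\<nu> E\<bar>"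
      using UD[OF UA, of "\<bar>\<nu> A\<bar> + 1"] by blast
    have D: "\<nu> (A - E) = \<nu> A - \<nu> E" using signed_Diff \<nu> A E by blast
    have "U E \<or> U (A - E)"
    proof (rule ccontr)
      assume "\<not> ?thesis"
      then obtain K1 K2 where K: "\<And>B. B \<in> sets M \<Longrightarrow> B \<subseteq> E \<Longrightarrow> \<bar>\<nu> B\<bar> \<le> K1"
          "\<And>B. B \<in> sets M \<Longrightarrow> B \<subseteq> A - E \<Longrightarrow> \<bar>\<nu> B\<bar> \<le> K2"
        unfolding U_def using A E by (metis not_le sets.Diff)
      obtain B where B: "B \<in> sets M" "B \<subseteq> A" "K1 + K2 < \<bar>\<nu> B\<bar>"
        using UD[OF UA, of "K1 + K2"] by blast
      have "\<nu> B = \<nu> (B \<inter> E) + \<nu> (B - E)"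
        using signed_Un[OF \<nu>, of "B \<inter> E" "B - E"] B E by (auto simp: Int_Diff_Un)
      moreover have "\<bar>\<nu> (B \<inter> E)\<bar> \<le> K1" "\<bar>\<nu> (B - E)\<bar> \<le> K2"
        using K(1)[of "B \<inter> E"] K(2)[of "B - E"] B E by blast+
      ultimately show False using B by linarith
    qed
    moreover have "A - (A - E) = E" using E by auto
    ultimately show ?thesis
      using E D by (smt (verit) Diff_subset)
  qed
  have "\<exists>A. \<forall>n. U (A n) \<and> (A (Suc n) \<subseteq> A n \<and> 1 < \<bar>\<nu> (A n - A (Suc n))\<bar>)"
    by (rule dependent_nat_choice) (use U0 step in auto)
  then obtain A where A: "\<And>n. U (A n)"
      "\<And>n. A (Suc n) \<subseteq> A n \<and> 1 < \<bar>\<nu> (A n - A (Suc n))\<bar>" by blast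
  have dec: "A n \<subseteq> A m" if "m \<le> n" for m n
    using A(2) lift_Suc_antimono_le[of A] that by blast
  have "disjoint_family (\<lambda>n. A n - A (Suc n))"
    unfolding disjoint_family_on_def
  proof (intro ballI impI)
    fix m n :: nat assume "m \<noteq> n"
    then consider "Suc m \<le> n" | "Suc n \<le> m" by linarith
    then show "(A m - A (Suc m)) \<inter> (A n - A (Suc n)) = {}"
      using dec by cases blast+
  qed
  moreover have "range (\<lambda>n. A n - A (Suc n)) \<subseteq> sets M"
    using A(1) by (auto simp: U_def)
  ultimately have "summable (\<lambda>n. \<nu> (A n - A (Suc n)))"
    using \<nu> unfolding countably_additive_signed_def by (meson sums_summable)
  then have "(\<lambda>n. \<nu> (A n - A (Suc n))) \<longlonglongrightarrow> 0" by (rule summable_LIMSEQ_zero)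
  then have "\<forall>\<^sub>F n in sequentially. \<bar>\<nu> (A n - A (Suc n))\<bar> < 1"
    by (auto dest!: tendstoD[where e=1])
  then obtain n where "\<bar>\<nu> (A n - A (Suc n))\<bar> < 1"
    using eventually_happens' sequentially_bot by blast
  then show False
    using A(2)[of n] by linarith
qed

lemma upper_variation_upper:
  assumes \<nu>: "countably_additive_signed M \<nu>" and "B \<in> sets M" "B \<subseteq> A"
  shows "\<nu> B \<le> upper_variation M \<nu> A"
proof -
  obtain K where "\<And>A. A \<in> sets M \<Longrightarrow> \<nu> A \<le> K" using signed_bounded[OF \<nu>] by blast
  then have "bdd_above (\<nu> ` {B \<in> sets M. B \<subseteq> A})" by (auto intro!: bdd_aboveI)
  then show ?thesis unfolding upper_variation_def using assms by (auto intro!: cSUP_upper)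
qed

lemma upper_variation_nonneg:
  assumes "countably_additive_signed M \<nu>"
  shows "0 \<le> upper_variation M \<nu> A"
  using upper_variation_upper[OF assms, of "{}" A] signed_empty[OF assms] by simp

lemma upper_variation_least:
  assumes "\<And>B. B \<in> sets M \<Longrightarrow> B \<subseteq> A \<Longrightarrow> \<nu> B \<le> K"
  shows "upper_variation M \<nu> A \<le> K"
  unfolding upper_variation_def
  by (rule cSUP_least) (use assms in auto)

lemma upper_variation_mono:
  assumes "countably_additive_signed M \<nu>" "A \<subseteq> A'"
  shows "upper_variation M \<nu> A \<le> upper_variation M \<nu> A'"
  using assms by (intro upper_variation_least upper_variation_upper) auto

lemma upper_variation_superadditive:
  assumes \<nu>: "countably_additive_signed M \<nu>" and "A \<inter> B = {}"
  shows "upper_variation M \<nu> A + upper_variation M \<nu> B \<le> upper_variation M \<nu> (A \<union> B)"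
proof -
  have "upper_variation M \<nu> A \<le> upper_variation M \<nu> (A \<union> B) - upper_variation M \<nu> B"
  proof (rule upper_variation_least)
    fix E assume E: "E \<in> sets M" "E \<subseteq> A"
    have "upper_variation M \<nu> B \<le> upper_variation M \<nu> (A \<union> B) - \<nu> E"
    proof (rule upper_variation_least)
      fix F assume F: "F \<in> sets M" "F \<subseteq> B"
      have "\<nu> E + \<nu> F = \<nu> (E \<union> F)" using signed_Un[OF \<nu>, of E F] E F assms(2) by (metis Int_mono subset_empty)
      also have "\<dots> \<le> upper_variation M \<nu> (A \<union> B)"
        using E F by (intro upper_variation_upper[OF \<nu>]) auto
      finally show "\<nu> F \<le> upper_variation M \<nu> (A \<union> B) - \<nu> E" by simp
    qed
    then show "\<nu> E \<le> upper_variation M \<nu> (A \<union> B) - upper_variation M \<nu> B" by simp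
  qed
  then show ?thesis by simp
qed

text \<open>A subset of the union is cut by the sets \<open>A i\<close> into competitors for the individual suprema, which gives one
inequality; the other one is superadditivity along finite partial unions.\<close>

lemma upper_variation_sums:
  assumes \<nu>: "countably_additive_signed M \<nu>"
    and A: "range A \<subseteq> sets M" "disjoint_family (A :: nat \<Rightarrow> _)"
  shows "(\<lambda>i. upper_variation M \<nu> (A i)) sums upper_variation M \<nu> (\<Union>i. A i)"
proof -
  let ?V = "upper_variation M \<nu>"
  have part: "(\<Sum>i<n. ?V (A i)) \<le> ?V (\<Union>i<n. A i)" for n
  proof (induction n)
    case (Suc n)
    have "A n \<inter> (\<Union>i<n. A i) = {}"
      using A(2) by (auto simp: disjoint_family_on_def) (metis IntI emptyE nat_neq_iff)
    then show ?case
      using Suc upper_variation_superadditive[OF \<nu>, of "A n" "\<Union>i<n. A i"]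
      by (simp add: lessThan_Suc)
  qed (use upper_variation_nonneg[OF \<nu>] in simp)
  have part': "(\<Sum>i<n. ?V (A i)) \<le> ?V (\<Union>i. A i)" for n
    using part[of n] upper_variation_mono[OF \<nu>, of "\<Union>i<n. A i" "\<Union>i. A i"] by force
  have summ: "summable (\<lambda>i. ?V (A i))"
    by (rule summableI_nonneg_bounded[OF upper_variation_nonneg[OF \<nu>] part'])
  have "?V (\<Union>i. A i) \<le> (\<Sum>i. ?V (A i))"
  proof (rule upper_variation_least)
    fix B assume B: "B \<in> sets M" "B \<subseteq> (\<Union>i. A i)"
    have "(\<lambda>i. \<nu> (B \<inter> A i)) sums \<nu> (\<Union>i. B \<inter> A i)"
    proof -
      have "range (\<lambda>i. B \<inter> A i) \<subseteq> sets M" "disjoint_family (\<lambda>i. B \<inter> A i)"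
        using A B by (auto simp: disjoint_family_on_def)
      then show ?thesis using \<nu> unfolding countably_additive_signed_def by blast
    qed
    moreover have "(\<Union>i. B \<inter> A i) = B" using B by auto
    ultimately have s: "(\<lambda>i. \<nu> (B \<inter> A i)) sums \<nu> B" by simp
    have "\<nu> (B \<inter> A i) \<le> ?V (A i)" for i
      using A B by (intro upper_variation_upper[OF \<nu>]) auto
    then show "\<nu> B \<le> (\<Sum>i. ?V (A i))"
      using s summ by (metis sums_unique suminf_le sums_summable)
  qed
  moreover have "(\<Sum>i. ?V (A i)) \<le> ?V (\<Union>i. A i)"
    by (rule suminf_le_const[OF summ part'])
  ultimately show ?thesis using summ by (simp add: sums_iff)
qed

lemma upper_variation_measure:
  assumes \<nu>: "countably_additive_signed M \<nu>"
  obtains \<mu> where "sets \<mu> = sets M" "finite_measure \<mu>"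
    "\<And>A. A \<in> sets M \<Longrightarrow> measure \<mu> A = upper_variation M \<nu> A"
proof -
  define \<mu> where "\<mu> = measure_of (space M) (sets M) (\<lambda>A. ennreal (upper_variation M \<nu> A))"
  have e: "emeasure \<mu> A = ennreal (upper_variation M \<nu> A)" if "A \<in> sets M" for A
  proof (rule emeasure_measure_of[OF \<mu>_def])
    show "positive (sets \<mu>) (\<lambda>A. ennreal (upper_variation M \<nu> A))"
      using upper_variation_least[of M "{}" \<nu> 0] signed_empty[OF \<nu>]
      by (auto simp: positive_def ennreal_eq_0_iff)
    show "countably_additive (sets \<mu>) (\<lambda>A. ennreal (upper_variation M \<nu> A))"
    proof (rule countably_additiveI)
      fix A :: "nat \<Rightarrow> _" assume "range A \<subseteq> sets \<mu>" "disjoint_family A"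
      then have "(\<lambda>i. upper_variation M \<nu> (A i)) sums upper_variation M \<nu> (\<Union>i. A i)"
        by (intro upper_variation_sums[OF \<nu>]) (auto simp: \<mu>_def)
      then show "(\<Sum>i. ennreal (upper_variation M \<nu> (A i))) = ennreal (upper_variation M \<nu> (\<Union>i. A i))"
        by (simp add: suminf_ennreal2 sums_iff upper_variation_nonneg[OF \<nu>])
    qed
  qed (use that in \<open>auto simp: \<mu>_def sets.space_closed\<close>)
  have s: "sets \<mu> = sets M" "space \<mu> = space M" by (auto simp: \<mu>_def)
  show ?thesis
  proof
    show "finite_measure \<mu>" by standard (simp add: e s)
    show "measure \<mu> A = upper_variation M \<nu> A" if "A \<in> sets M" for A
      using e[OF that] upper_variation_nonneg[OF \<nu>] by (simp add: measure_def)
  qed (fact s)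
qed

lemma signed_uminus:
  assumes "countably_additive_signed M \<nu>"
  shows "countably_additive_signed M (\<lambda>A. - \<nu> A)"
  using assms unfolding countably_additive_signed_def by (auto intro: sums_minus)

text \<open>Taking complements \<open>B \<mapsto> A - B\<close> turns the values of \<open>\<nu>\<close> on subsets of \<open>A\<close> into those of \<open>- \<nu>\<close>,
shifted by \<open>\<nu> A\<close>.\<close>

lemma jordan_decomposition:
  assumes \<nu>: "countably_additive_signed M \<nu>" and A: "A \<in> sets M"
  shows "\<nu> A = upper_variation M \<nu> A - upper_variation M (\<lambda>A. - \<nu> A) A"
proof (rule antisym)
  have \<nu>': "countably_additive_signed M (\<lambda>A. - \<nu> A)" by (rule signed_uminus[OF \<nu>])
  have d: "\<nu> (A - B) = \<nu> A - \<nu> B" if "B \<in> sets M" "B \<subseteq> A" for B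
    using signed_Diff[OF \<nu> A] that by blast
  have "upper_variation M (\<lambda>A. - \<nu> A) A \<le> upper_variation M \<nu> A - \<nu> A"
  proof (rule upper_variation_least)
    fix B assume B: "B \<in> sets M" "B \<subseteq> A"
    then show "- \<nu> B \<le> upper_variation M \<nu> A - \<nu> A"
      using upper_variation_upper[OF \<nu>, of "A - B" A] A d[OF B] by auto
  qed
  then show "\<nu> A \<le> upper_variation M \<nu> A - upper_variation M (\<lambda>A. - \<nu> A) A" by simp
  have "upper_variation M \<nu> A \<le> \<nu> A + upper_variation M (\<lambda>A. - \<nu> A) A"
  proof (rule upper_variation_least)
    fix B assume B: "B \<in> sets M" "B \<subseteq> A"
    then show "\<nu> B \<le> \<nu> A + upper_variation M (\<lambda>A. - \<nu> A) A"
      using upper_variation_upper[OF \<nu>', of "A - B" A] A d[OF B] by auto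
  qed
  then show "upper_variation M \<nu> A - upper_variation M (\<lambda>A. - \<nu> A) A \<le> \<nu> A" by simp
qed

section \<open>Uniformly distributed measures\<close>

text \<open>Both sides are the product measure of the pairs in \<open>A \<times> B\<close> at distance less than \<open>r\<close>, sliced in the two
possible directions.\<close>

lemma ball_double_counting:
  fixes \<mu> \<sigma> :: "'a::{metric_space, second_countable_topology} measure"
  assumes sm: "sigma_finite_measure \<mu>" and ss: "sigma_finite_measure \<sigma>"
    and [measurable_cong]: "sets \<mu> = sets borel" "sets \<sigma> = sets borel"
    and [measurable]: "A \<in> sets borel" "B \<in> sets borel"
  shows "(\<integral>\<^sup>+x\<in>A. emeasure \<sigma> (ball x r \<inter> B) \<partial>\<mu>) = (\<integral>\<^sup>+y\<in>B. emeasure \<mu> (ball y r \<inter> A) \<partial>\<sigma>)"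
proof -
  interpret pair_sigma_finite \<mu> \<sigma>
    using sm ss by (simp add: pair_sigma_finite_def)
  let ?X = "{p. fst p \<in> A \<and> snd p \<in> B \<and> dist (fst p) (snd p) < r}"
  have "{p \<in> space (\<mu> \<Otimes>\<^sub>M \<sigma>). fst p \<in> A \<and> snd p \<in> B \<and> dist (fst p) (snd p) < r} \<in> sets (\<mu> \<Otimes>\<^sub>M \<sigma>)"
    by measurable
  then have X: "?X \<in> sets (\<mu> \<Otimes>\<^sub>M \<sigma>)"
    by (simp add: space_pair_measure assms(3,4)[THEN sets_eq_imp_space_eq])
  have 1: "emeasure \<sigma> (Pair x -` ?X) = emeasure \<sigma> (ball x r \<inter> B) * indicator A x" for x
    by (auto simp: indicator_def ball_def vimage_def intro!: arg_cong[where f="emeasure \<sigma>"])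
  have 2: "emeasure \<mu> ((\<lambda>x. (x, y)) -` ?X) = emeasure \<mu> (ball y r \<inter> A) * indicator B y" for y
    by (auto simp: indicator_def ball_def vimage_def dist_commute intro!: arg_cong[where f="emeasure \<mu>"])
  show ?thesis
    using M2.emeasure_pair_measure_alt[OF X, unfolded 1] emeasure_pair_measure_alt2[OF X, unfolded 2]
    by simp
qed

text \<open>Let \<open>V r\<close> be the set of points whose \<open>r\<close>-ball lies in \<open>U\<close>. Double counting the pairs in \<open>V r \<times> U\<close> gives
\<open>c r * \<mu> (V r) \<le> c' r * \<sigma> U\<close>, and \<open>V r\<close> exhausts \<open>U\<close> as \<open>r\<close> tends to 0. The two factors \<open>a\<close> and \<open>b\<close>
let the inequality be used with the roles of \<open>\<mu>\<close> and \<open>\<sigma>\<close> exchanged.\<close>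

lemma uniformly_distributed_open_le:
  fixes \<mu> \<sigma> :: "'a::{metric_space, second_countable_topology} measure"
  assumes sm: "sigma_finite_measure \<mu>" and ss: "sigma_finite_measure \<sigma>"
    and sets: "sets \<mu> = sets borel" "sets \<sigma> = sets borel"
    and \<sigma>: "\<And>r. 0 < r \<Longrightarrow> AE x in \<mu>. emeasure \<sigma> (ball x r) = c r"
    and \<mu>: "\<And>r. 0 < r \<Longrightarrow> AE y in \<sigma>. emeasure \<mu> (ball y r) = c' r"
    and pos: "\<And>r. 0 < r \<Longrightarrow> c r \<noteq> 0" "\<And>r. 0 < r \<Longrightarrow> c r \<noteq> \<infinity>"
    and cc: "\<And>r. 0 < r \<Longrightarrow> b * c' r = a * c r"
    and U: "open U"
  shows "b * emeasure \<mu> U \<le> a * emeasure \<sigma> U"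
proof -
  note [measurable_cong] = sets
  define V where "V r = - (\<Union>y\<in>-U. ball y r)" for r
  have V: "closed (V r)" for r
    unfolding V_def by (intro closed_Compl open_UN) auto
  then have [measurable]: "V r \<in> sets borel" for r by auto
  have [measurable]: "U \<in> sets borel" using U by auto
  have le: "b * emeasure \<mu> (V r) \<le> a * emeasure \<sigma> U" if r: "0 < r" for r
  proof -
    have sub: "ball x r \<inter> U = ball x r" if "x \<in> V r" for x
      using that by (force simp: V_def dist_commute)
    have "c r * emeasure \<mu> (V r) = (\<integral>\<^sup>+x\<in>V r. emeasure \<sigma> (ball x r) \<partial>\<mu>)"
      using \<sigma>[OF r] by (subst nn_integral_cmult_indicator[symmetric])
        (auto simp: sets intro!: nn_integral_cong_AE)
    also have "\<dots> = (\<integral>\<^sup>+x\<in>V r. emeasure \<sigma> (ball x r \<inter> U) \<partial>\<mu>)"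
      using sub by (intro nn_integral_cong) (auto simp: indicator_def)
    also have "\<dots> = (\<integral>\<^sup>+y\<in>U. emeasure \<mu> (ball y r \<inter> V r) \<partial>\<sigma>)"
      by (intro ball_double_counting sm ss sets) auto
    also have "\<dots> \<le> (\<integral>\<^sup>+y\<in>U. emeasure \<mu> (ball y r) \<partial>\<sigma>)"
      by (intro nn_integral_mono mult_right_mono emeasure_mono) (auto simp: sets)
    also have "\<dots> = c' r * emeasure \<sigma> U"
      using \<mu>[OF r] by (subst nn_integral_cmult_indicator[symmetric])
        (auto simp: sets intro!: nn_integral_cong_AE)
    finally have "c r * emeasure \<mu> (V r) \<le> c' r * emeasure \<sigma> U" .
    then have "b * (c r * emeasure \<mu> (V r)) \<le> b * (c' r * emeasure \<sigma> U)"
      by (rule mult_left_mono) simp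
    also have "\<dots> = c r * (a * emeasure \<sigma> U)"
      using cc[OF r] by (metis mult.assoc mult.commute)
    finally have "c r * (b * emeasure \<mu> (V r)) \<le> c r * (a * emeasure \<sigma> U)"
      by (simp add: ac_simps)
    then show ?thesis
      using pos[OF r] by (metis ennreal_mult_le_mult_iff infinity_ennreal_def)
  qed
  have un: "(\<Union>n. V (1 / real (Suc n))) = U"
  proof
    show "(\<Union>n. V (1 / real (Suc n))) \<subseteq> U"
    proof
      fix x assume "x \<in> (\<Union>n. V (1 / real (Suc n)))"
      then obtain n where "x \<in> V (1 / real (Suc n))" by blast
      moreover have "x \<in> ball x (1 / real (Suc n))" by simp
      ultimately show "x \<in> U" unfolding V_def by blast
    qed
    show "U \<subseteq> (\<Union>n. V (1 / real (Suc n)))"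
    proof
      fix x assume "x \<in> U"
      then obtain e where e: "0 < e" "ball x e \<subseteq> U" using U openE by blast
      then obtain n where "1 / real (Suc n) < e" using nat_approx_posE by blast
      then have "x \<in> V (1 / real (Suc n))"
        using e unfolding V_def by (force simp: dist_commute)
      then show "x \<in> (\<Union>n. V (1 / real (Suc n)))" by blast
    qed
  qed
  have "incseq (\<lambda>n. V (1 / real (Suc n)))"
  proof (rule incseq_SucI)
    fix n
    have "1 / real (Suc (Suc n)) \<le> 1 / real (Suc n)" by (simp add: field_simps)
    then show "V (1 / real (Suc n)) \<subseteq> V (1 / real (Suc (Suc n)))"
      unfolding V_def by (intro Compl_anti_mono UN_mono order_refl subset_ball) auto
  qed
  then have "emeasure \<mu> U = (SUP n. emeasure \<mu> (V (1 / real (Suc n))))"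
    by (subst un[symmetric], subst SUP_emeasure_incseq) (auto simp: sets)
  then have "b * emeasure \<mu> U = (SUP n. b * emeasure \<mu> (V (1 / real (Suc n))))"
    by (simp add: SUP_mult_left_ennreal)
  also have "\<dots> \<le> a * emeasure \<sigma> U" by (intro SUP_least le) simp
  finally show ?thesis .
qed

text \<open>It suffices that the masses of balls are constant around almost every point, up to the common factor
\<open>a\<close>: the centres are only needed where the measures live, for instance on a sphere.\<close>

lemma uniformly_distributed_unique:
  fixes \<mu> \<sigma> :: "'a::euclidean_space measure"
  assumes sets: "sets \<mu> = sets borel" "sets \<sigma> = sets borel"
    and fin: "\<And>r. emeasure \<mu> (ball 0 r) < \<infinity>" "\<And>r. emeasure \<sigma> (ball 0 r) < \<infinity>"
    and \<sigma>: "\<And>r. 0 < r \<Longrightarrow> AE x in \<mu>. emeasure \<sigma> (ball x r) = c r"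
    and \<mu>: "\<And>r. 0 < r \<Longrightarrow> AE y in \<sigma>. emeasure \<mu> (ball y r) = a * c r"
    and a: "a \<noteq> 0" "a \<noteq> \<infinity>"
    and pos: "\<And>r. 0 < r \<Longrightarrow> c r \<noteq> 0" "\<And>r. 0 < r \<Longrightarrow> c r \<noteq> \<infinity>"
    and A: "A \<in> sets borel"
  shows "emeasure \<mu> A = a * emeasure \<sigma> A"
proof -
  have sf: "sigma_finite_measure M" if "sets M = sets borel" "\<And>r. emeasure M (ball 0 r) < \<infinity>"
    for M :: "'a measure"
  proof
    have "(\<Union>n::nat. ball 0 (real n)) = (UNIV :: 'a set)"
      by (auto simp: reals_Archimedean2)
    then show "\<exists>A. countable A \<and> A \<subseteq> sets M \<and> \<Union> A = space M \<and> (\<forall>a\<in>A. emeasure M a \<noteq> \<infinity>)"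
      using that by (intro exI[of _ "range (\<lambda>n::nat. ball 0 (real n))"])
        (auto simp: sets_eq_imp_space_eq[OF that(1)] less_top[symmetric])
  qed
  have eq: "emeasure \<mu> U = a * emeasure \<sigma> U" if "open U" for U
  proof (rule antisym)
    show "emeasure \<mu> U \<le> a * emeasure \<sigma> U"
      using uniformly_distributed_open_le[OF sf[OF sets(1) fin(1)] sf[OF sets(2) fin(2)] sets \<sigma> \<mu> pos,
          of 1 a U] that by simp
    show "a * emeasure \<sigma> U \<le> emeasure \<mu> U"
      using uniformly_distributed_open_le[OF sf[OF sets(2) fin(2)] sf[OF sets(1) fin(1)]
          sets(2,1) \<mu> \<sigma>, of a 1 U] that a pos by (simp add: ennreal_mult_eq_top_iff)
  qed
  have "\<mu> = scale_measure a \<sigma>"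
  proof (rule measure_eqI_generator_eq)
    show "Int_stable (Collect open :: 'a set set)" by (auto simp: Int_stable_def)
    show "(\<Union>n::nat. ball 0 (real n)) = (UNIV :: 'a set)" by (auto simp: reals_Archimedean2)
    show "emeasure \<mu> X = emeasure (scale_measure a \<sigma>) X" if "X \<in> Collect open" for X
      using that eq by (simp add: sets)
  qed (use fin in \<open>auto simp: sets sets_borel less_top[symmetric]\<close>)
  then show ?thesis by simp
qed

section \<open>Orthonormal bases and orthogonal maps\<close>

definition orthonormal :: "'a::euclidean_space set \<Rightarrow> bool" where
  "orthonormal B \<longleftrightarrow> pairwise orthogonal B \<and> (\<forall>b\<in>B. norm b = 1)"

lemma orthonormal_inner:
  assumes "orthonormal B" "b \<in> B" "c \<in> B"
  shows "b \<bullet> c = (if b = c then 1 else 0)"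
  using assms norm_eq_1 unfolding orthonormal_def pairwise_def orthogonal_def by auto

lemma orthonormal_independent: "orthonormal B \<Longrightarrow> independent B"
  by (rule pairwise_orthogonal_independent) (auto simp: orthonormal_def)

lemma orthonormal_finite: "orthonormal B \<Longrightarrow> finite B"
  using orthonormal_independent independent_imp_finite by blast

lemma orthonormal_Basis: "orthonormal Basis"
  by (auto simp: orthonormal_def pairwise_def orthogonal_def inner_Basis)

lemma orthonormal_extend:
  fixes B :: "'a::euclidean_space set"
  assumes B: "orthonormal B"
  obtains B' where "B \<subseteq> B'" "orthonormal B'" "span B' = UNIV" "card B' = DIM('a)"
proof -
  let ?N = "{y. \<forall>x\<in>span B. orthogonal x y}"
  obtain C where C: "C \<subseteq> ?N" "pairwise orthogonal C" "\<And>x. x \<in> C \<Longrightarrow> norm x = 1"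
      "independent C" "card C = dim ?N"
    by (rule orthonormal_basis_subspace[OF subspace_orthogonal_to_vectors[of "span B"]]) blast
  have BC: "orthogonal b c" "orthogonal c b" if "b \<in> B" "c \<in> C" for b c
    using that C(1) span_base[of b B] by (auto simp: orthogonal_commute)
  have "B \<inter> C = {}"
  proof -
    have False if "x \<in> B" "x \<in> C" for x
      using BC(1)[OF that] C(3)[OF that(2)] by (simp add: orthogonal_def dot_square_norm)
    then show ?thesis by blast
  qed
  have on: "orthonormal (B \<union> C)"
    using B C BC by (auto simp: orthonormal_def pairwise_def)
  have "card (B \<union> C) = card B + card C"
    using orthonormal_finite[OF on] \<open>B \<inter> C = {}\<close> by (simp add: card_Un_disjoint)
  also have "card B = dim (span B)"
    using orthonormal_independent[OF B] by (simp add: dim_eq_card_independent)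
  also have "\<dots> + card C = DIM('a)"
    using dim_subspace_orthogonal_to_vectors[OF subspace_span subspace_UNIV subset_UNIV, of B] C(5)
    by simp
  finally have card: "card (B \<union> C) = DIM('a)" .
  then have "span (B \<union> C) = UNIV"
    using orthonormal_independent[OF on] card_eq_dim[of "B \<union> C" UNIV] orthonormal_finite[OF on]
    by auto
  then show ?thesis using that[of "B \<union> C"] on card by blast
qed

lemma orthogonal_transformation_of_bases:
  fixes B B' :: "'a::euclidean_space set"
  assumes B: "orthonormal B" "span B = UNIV" and B': "orthonormal B'" and h: "bij_betw h B B'"
  obtains Q where "orthogonal_transformation Q" "\<And>b. b \<in> B \<Longrightarrow> Q b = h b"
proof -
  define Q where "Q x = (\<Sum>b\<in>B. (x \<bullet> b) *\<^sub>R h b)" for x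
  have fin: "finite B" using orthonormal_finite[OF B(1)] .
  have ex: "(\<Sum>b\<in>B. (x \<bullet> b) *\<^sub>R b) = x" for x
    using B fin by (intro orthonormal_basis_expand) (auto simp: orthonormal_def)
  have hh: "h b \<bullet> h c = (if b = c then 1 else 0)" if "b \<in> B" "c \<in> B" for b c
    using orthonormal_inner[OF B', of "h b" "h c"] that h
    by (auto simp: bij_betw_def inj_on_eq_iff)
  have "linear Q"
    by (rule linearI) (auto simp: Q_def algebra_simps scaleR_sum_right sum.distrib)
  moreover have "Q x \<bullet> Q y = x \<bullet> y" for x y
  proof -
    have "Q x \<bullet> Q y = (\<Sum>b\<in>B. (x \<bullet> b) * (\<Sum>c\<in>B. (y \<bullet> c) * (h b \<bullet> h c)))"
      unfolding Q_def by (simp add: inner_sum_left) (simp add: inner_sum_right sum_distrib_left)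
    also have "\<dots> = (\<Sum>b\<in>B. (x \<bullet> b) * (y \<bullet> b))"
    proof (rule sum.cong[OF refl])
      fix b assume b: "b \<in> B"
      have "(\<Sum>c\<in>B. (y \<bullet> c) * (h b \<bullet> h c)) = (\<Sum>c\<in>B. if b = c then y \<bullet> c else 0)"
        using b by (intro sum.cong) (auto simp: hh)
      then show "x \<bullet> b * (\<Sum>c\<in>B. y \<bullet> c * (h b \<bullet> h c)) = x \<bullet> b * (y \<bullet> b)"
        using b fin by (simp add: sum.delta')
    qed
    also have "\<dots> = (\<Sum>b\<in>B. (x \<bullet> b) *\<^sub>R b) \<bullet> y"
      by (simp add: inner_sum_left inner_commute[of y])
    finally show ?thesis by (simp add: ex)
  qed
  ultimately have "orthogonal_transformation Q" by (simp add: orthogonal_transformation_def)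
  moreover have "Q b = h b" if "b \<in> B" for b
  proof -
    have "Q b = (\<Sum>c\<in>B. if b = c then h c else 0)"
      unfolding Q_def using that orthonormal_inner[OF B(1) that] by (intro sum.cong) auto
    then show ?thesis using that fin by (simp add: sum.delta')
  qed
  ultimately show ?thesis using that by blast
qed

text \<open>An orthonormal basis of \<open>L\<close> is matched with one of \<open>L'\<close>, and the remaining vectors of two full bases with
each other. This is what makes the value of an invariant functional at a subspace depend on the dimension only.\<close>

lemma orthogonal_transformation_between_subspaces:
  fixes L L' :: "'a::euclidean_space set"
  assumes L: "subspace L" "subspace L'" "dim L = dim L'"
  obtains Q where "orthogonal_transformation Q" "Q ` L = L'"
proof -
  obtain B where B: "orthonormal B" "span B = L" "card B = dim L"
    using orthonormal_basis_subspace[OF L(1)] unfolding orthonormal_def by metis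
  obtain C where C: "orthonormal C" "span C = L'" "card C = dim L'"
    using orthonormal_basis_subspace[OF L(2)] unfolding orthonormal_def by metis
  obtain B' where B': "B \<subseteq> B'" "orthonormal B'" "span B' = UNIV" "card B' = DIM('a)"
    using orthonormal_extend[OF B(1)] .
  obtain C' where C': "C \<subseteq> C'" "orthonormal C'" "span C' = UNIV" "card C' = DIM('a)"
    using orthonormal_extend[OF C(1)] .
  have fin: "finite B" "finite C" "finite B'" "finite C'"
    using orthonormal_finite B C B' C' by blast+
  obtain f where f: "bij_betw f B C"
    using finite_same_card_bij[of B C] fin B C L by auto
  obtain g where g: "bij_betw g (B' - B) (C' - C)"
    using finite_same_card_bij[of "B' - B" "C' - C"] fin B C L B' C'
    by (auto simp: card_Diff_subset)
  define h where "h b = (if b \<in> B then f b else g b)" for b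
  have "bij_betw h (B \<union> (B' - B)) (C \<union> (C' - C))"
  proof (rule bij_betw_combine)
    show "bij_betw h B C" using f by (subst bij_betw_cong[of _ _ f]) (auto simp: h_def)
    show "bij_betw h (B' - B) (C' - C)"
      using g by (subst bij_betw_cong[of _ _ g]) (auto simp: h_def)
  qed auto
  then have "bij_betw h B' C'" using B' C' by (simp add: Un_absorb1)
  then obtain Q where Q: "orthogonal_transformation Q" "\<And>b. b \<in> B' \<Longrightarrow> Q b = h b"
    using orthogonal_transformation_of_bases[OF B'(2,3) C'(2)] by blast
  have "Q ` B = f ` B" using Q(2) B'(1) by (auto simp: h_def intro!: image_cong)
  also have "\<dots> = C" using f by (simp add: bij_betw_def)
  finally have "Q ` L = L'"
    using orthogonal_transformation_linear[OF Q(1)] B C by (metis linear_span_image)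
  then show ?thesis using that Q by blast
qed

lemma orthogonal_transformation_vimage_ball:
  fixes Q :: "'a::euclidean_space \<Rightarrow> 'a"
  assumes "orthogonal_transformation Q"
  shows "Q -` ball (Q x) r = ball x r"
  using orthogonal_transformation_norm[OF assms] orthogonal_transformation_linear[OF assms]
  by (auto simp: dist_norm linear_diff[symmetric])

lemma orthogonal_transformation_borel:
  fixes Q :: "'a::euclidean_space \<Rightarrow> 'a"
  assumes "orthogonal_transformation Q"
  shows "Q \<in> borel_measurable borel"
  using orthogonal_transformation_linear[OF assms]
  by (intro borel_measurable_continuous_onI linear_continuous_on) (simp add: linear_conv_bounded_linear)

text \<open>Preimages of balls under \<open>Q\<close> are balls of the same radius, so Lebesgue measure and its image are uniformly
distributed with the same ball masses.\<close>

lemma distr_lborel_orthogonal: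
  fixes Q :: "'a::euclidean_space \<Rightarrow> 'a"
  assumes Q: "orthogonal_transformation Q"
  shows "distr lborel borel Q = lborel"
proof (rule measure_eqI)
  fix A assume A: "A \<in> sets (distr lborel borel Q)"
  note [measurable] = orthogonal_transformation_borel[OF Q]
  have ball: "emeasure lborel (ball x r) = ennreal (r ^ DIM('a) * measure lborel (ball (0::'a) 1))"
    if "0 < r" for x :: 'a and r
    using that emeasure_eq_ennreal_measure[of lborel "ball x r"] emeasure_lborel_ball_finite[of x r]
      content_ball_conv_unit_ball[of r x] by auto
  have vimage: "Q -` ball y r = ball (inv Q y) r" for y r
    using orthogonal_transformation_vimage_ball[OF Q, of "inv Q y" r]
    unfolding surj_f_inv_f[OF orthogonal_transformation_surj[OF Q]] .
  have emd: "emeasure (distr lborel borel Q) (ball y r) = emeasure lborel (ball (inv Q y) r)" for y r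
    by (simp add: emeasure_distr vimage)
  have "emeasure (distr lborel borel Q) A = 1 * emeasure lborel A"
  proof (rule uniformly_distributed_unique)
    show "AE x in distr lborel borel Q. emeasure lborel (ball x r) =
        ennreal (r ^ DIM('a) * measure lborel (ball (0::'a) 1))" if "0 < r" for r
      by (rule AE_I2) (rule ball[OF that])
    show "AE y in lborel. emeasure (distr lborel borel Q) (ball y r) =
        1 * ennreal (r ^ DIM('a) * measure lborel (ball (0::'a) 1))" if "0 < r" for r
      using ball[OF that] by (simp add: emd)
  qed (use A content_ball_pos[of 1 "0::'a"] in
      \<open>auto simp: emd emeasure_lborel_ball_finite[unfolded infinity_ennreal_def] ennreal_eq_0_iff not_le\<close>)
  then show "emeasure (distr lborel borel Q) A = emeasure lborel A" by simp
qed simp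

section \<open>The Gaussian measure on a subspace\<close>

definition std_gaussian :: "'a::euclidean_space measure" where
  "std_gaussian = density lborel (\<lambda>x. \<Prod>i\<in>Basis. ennreal (std_normal_density (x \<bullet> i)))"

lemma sets_std_gaussian [simp, measurable_cong]: "sets std_gaussian = sets borel"
  and space_std_gaussian [simp]: "space std_gaussian = UNIV"
  by (simp_all add: std_gaussian_def)

lemma std_gaussian_box:
  assumes A: "\<And>i. i \<in> Basis \<Longrightarrow> A i \<in> sets borel"
  shows "emeasure std_gaussian {x::'a::euclidean_space. \<forall>i\<in>Basis. x \<bullet> i \<in> A i} =
    (\<Prod>i\<in>Basis. emeasure (density lborel (\<lambda>t. ennreal (std_normal_density t))) (A i))"
proof -
  note [measurable] = A
  have "{x \<in> space borel. \<forall>i\<in>Basis. (x::'a) \<bullet> i \<in> A i} \<in> sets borel" by measurable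
  then have S: "{x. \<forall>i\<in>Basis. (x::'a) \<bullet> i \<in> A i} \<in> sets borel" by simp
  have ind: "indicator {x. \<forall>i\<in>Basis. x \<bullet> i \<in> A i} x = (\<Prod>i\<in>Basis. indicator (A i) (x \<bullet> i) :: ennreal)"
    for x :: 'a
    by (auto simp: indicator_def prod_eq_1_iff split: if_splits)
  have "emeasure std_gaussian {x::'a. \<forall>i\<in>Basis. x \<bullet> i \<in> A i} =
      (\<integral>\<^sup>+x. (\<Prod>i\<in>Basis. ennreal (std_normal_density (x \<bullet> i)) * indicator (A i) (x \<bullet> i)) \<partial>(lborel :: 'a measure))"
    unfolding std_gaussian_def using S
    by (subst emeasure_density) (auto simp: ind prod.distrib)
  also have "\<dots> = (\<Prod>i\<in>(Basis::'a set). \<integral>\<^sup>+t. ennreal (std_normal_density t) * indicator (A i) t \<partial>lborel)"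
    by (rule nn_integral_lborel_prod) auto
  also have "\<dots> = (\<Prod>i\<in>(Basis::'a set). emeasure (density lborel (\<lambda>t. ennreal (std_normal_density t))) (A i))"
    by (intro prod.cong refl) (simp add: emeasure_density A)
  finally show ?thesis .
qed

lemma prod_std_normal_density:
  fixes x :: "'a::euclidean_space"
  shows "(\<Prod>i\<in>Basis. std_normal_density (x \<bullet> i)) =
    (1 / sqrt (2 * pi)) ^ DIM('a) * exp (- (norm x)\<^sup>2 / 2)"
proof -
  have "(\<Prod>i\<in>Basis. std_normal_density (x \<bullet> i)) =
      (\<Prod>i\<in>(Basis::'a set). 1 / sqrt (2 * pi)) * (\<Prod>i\<in>Basis. exp (- (x \<bullet> i)\<^sup>2 / 2))"
    by (simp only: std_normal_density_def prod.distrib)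
  moreover have "(\<Prod>i\<in>Basis. exp (- (x \<bullet> i)\<^sup>2 / 2)) = exp (\<Sum>i\<in>Basis. - (x \<bullet> i)\<^sup>2 / 2)"
    by (simp add: exp_sum)
  moreover have "(\<Sum>i\<in>Basis. (x \<bullet> i)\<^sup>2) = (norm x)\<^sup>2"
    unfolding power2_norm_eq_inner by (subst euclidean_inner) (simp add: power2_eq_square)
  then have "(\<Sum>i\<in>Basis. - (x \<bullet> i)\<^sup>2 / 2) = - (norm x)\<^sup>2 / 2"
    by (simp add: sum_divide_distrib[symmetric] sum_negf)
  ultimately show ?thesis by simp
qed

lemma distr_std_gaussian_orthogonal:
  fixes Q :: "'a::euclidean_space \<Rightarrow> 'a"
  assumes Q: "orthogonal_transformation Q"
  shows "distr std_gaussian borel Q = std_gaussian"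
proof (rule measure_eqI)
  note [measurable] = orthogonal_transformation_borel[OF Q]
  let ?g = "\<lambda>x::'a. \<Prod>i\<in>Basis. ennreal (std_normal_density (x \<bullet> i))"
  have g: "?g (Q x) = ?g x" for x
    by (simp add: prod_ennreal prod_std_normal_density orthogonal_transformation_norm[OF Q])
  fix A assume "A \<in> sets (distr std_gaussian borel Q)"
  then have [measurable]: "A \<in> sets borel" by simp
  have "Q -` A \<in> sets borel"
    using measurable_sets[OF orthogonal_transformation_borel[OF Q] \<open>A \<in> sets borel\<close>] by simp
  then have "emeasure (distr std_gaussian borel Q) A = (\<integral>\<^sup>+x. ?g x * indicator (Q -` A) x \<partial>lborel)"
    by (simp add: emeasure_distr std_gaussian_def emeasure_density)
  also have "\<dots> = (\<integral>\<^sup>+x. ?g (Q x) * indicator A (Q x) \<partial>lborel)"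
    by (simp only: g indicator_vimage)
  also have "\<dots> = (\<integral>\<^sup>+x. ?g x * indicator A x \<partial>distr lborel borel Q)"
    by (subst nn_integral_distr) auto
  also have "\<dots> = emeasure std_gaussian A"
    by (simp add: distr_lborel_orthogonal[OF Q] std_gaussian_def emeasure_density)
  finally show "emeasure (distr std_gaussian borel Q) A = emeasure std_gaussian A" .
qed simp

lemma prob_space_std_normal: "prob_space (density lborel (\<lambda>t. ennreal (std_normal_density t)))"
  by (rule prob_space_normal_density) simp

lemma prob_space_std_gaussian: "prob_space (std_gaussian :: 'a::euclidean_space measure)"
proof
  have "emeasure (density lborel (\<lambda>t. ennreal (std_normal_density t))) UNIV = 1"
    using prob_space.emeasure_space_1[OF prob_space_std_normal] by simp
  then show "emeasure (std_gaussian :: 'a measure) (space std_gaussian) = 1"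
    using std_gaussian_box[of "\<lambda>_::'a. UNIV"] by simp
qed

text \<open>Coordinates of a standard Gaussian vector along orthonormal vectors are independent and standard normal:
a rotation that takes the standard basis to an extension of \<open>B\<close> reduces this to the standard coordinates.\<close>

lemma std_gaussian_coordinates:
  fixes B :: "'a::euclidean_space set"
  assumes B: "orthonormal B"
  shows "distr std_gaussian (\<Pi>\<^sub>M b\<in>B. borel) (\<lambda>x. \<lambda>b\<in>B. x \<bullet> b) =
    (\<Pi>\<^sub>M b\<in>B. density lborel (\<lambda>t. ennreal (std_normal_density t)))"
proof -
  let ?N = "density lborel (\<lambda>t. ennreal (std_normal_density t))"
  interpret N: prob_space ?N by (rule prob_space_std_normal)
  interpret P: product_sigma_finite "\<lambda>b::'a. ?N" ..
  obtain B' where B': "B \<subseteq> B'" "orthonormal B'" "span B' = UNIV" "card B' = DIM('a)"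
    using orthonormal_extend[OF B] .
  obtain h :: "'a \<Rightarrow> 'a" where h: "bij_betw h Basis B'"
    using finite_same_card_bij[of "Basis :: 'a set" B'] orthonormal_finite[OF B'(2)] B'(4) by auto
  obtain Q where Q: "orthogonal_transformation Q" "\<And>i. i \<in> Basis \<Longrightarrow> Q i = h i"
    using orthogonal_transformation_of_bases[OF orthonormal_Basis span_Basis B'(2) h] by blast
  have fin: "finite B" by (rule orthonormal_finite[OF B])
  show ?thesis
  proof (rule P.PiM_eqI[OF fin])
    show "sets (distr std_gaussian (\<Pi>\<^sub>M b\<in>B. borel) (\<lambda>x. \<lambda>b\<in>B. x \<bullet> b)) = sets (\<Pi>\<^sub>M b\<in>B. ?N)"
      by (simp cong: sets_PiM_cong)
    fix A assume A: "\<And>b. b \<in> B \<Longrightarrow> A b \<in> sets ?N"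
    have m: "(\<lambda>x::'a. \<lambda>b\<in>B. x \<bullet> b) \<in> measurable borel (\<Pi>\<^sub>M b\<in>B. borel)"
      by (rule measurable_restrict) simp
    \<comment> \<open>Coordinates of the extended basis outside \<open>B\<close> are left unconstrained.\<close>
    define A' where "A' i = (if h i \<in> B then A (h i) else UNIV)" for i
    have A': "A' i \<in> sets borel" if "i \<in> Basis" for i
      using A by (auto simp: A'_def)
    have PiE: "Pi\<^sub>E B A \<in> sets (\<Pi>\<^sub>M b\<in>B. borel)"
      using A fin by (intro sets_PiM_I_finite) auto
    then have S: "{x::'a. \<forall>b\<in>B. x \<bullet> b \<in> A b} \<in> sets borel"
      using measurable_sets[OF m PiE] by (simp add: vimage_def PiE_iff)
    have "emeasure (distr std_gaussian (\<Pi>\<^sub>M b\<in>B. borel) (\<lambda>x. \<lambda>b\<in>B. x \<bullet> b)) (Pi\<^sub>E B A) =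
        emeasure std_gaussian {x::'a. \<forall>b\<in>B. x \<bullet> b \<in> A b}"
      using PiE m by (subst emeasure_distr) (auto simp: vimage_def PiE_iff)
    also have "\<dots> = emeasure (distr std_gaussian borel Q) {x::'a. \<forall>b\<in>B. x \<bullet> b \<in> A b}"
      by (simp add: distr_std_gaussian_orthogonal[OF Q(1)])
    also have "\<dots> = emeasure std_gaussian {x. \<forall>b\<in>B. Q x \<bullet> b \<in> A b}"
      using S orthogonal_transformation_borel[OF Q(1)] by (subst emeasure_distr) (auto simp: vimage_def)
    also have "{x. \<forall>b\<in>B. Q x \<bullet> b \<in> A b} = {x. \<forall>i\<in>Basis. x \<bullet> i \<in> A' i}"
    proof -
      have "Q x \<bullet> h i = x \<bullet> i" if "i \<in> Basis" for x i
        using Q that by (metis orthogonal_transformation_def)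
      moreover have "B \<subseteq> h ` Basis" using B' h by (simp add: bij_betw_def)
      ultimately show ?thesis by (auto simp: A'_def)
    qed
    also have "emeasure std_gaussian {x::'a. \<forall>i\<in>Basis. x \<bullet> i \<in> A' i} = (\<Prod>i\<in>Basis. emeasure ?N (A' i))"
      by (rule std_gaussian_box[OF A'])
    also have "\<dots> = (\<Prod>b\<in>B'. emeasure ?N (if b \<in> B then A b else UNIV))"
      unfolding A'_def by (rule prod.reindex_bij_betw[OF h])
    also have "\<dots> = (\<Prod>b\<in>B. emeasure ?N (A b))"
      using B' N.emeasure_space_1 orthonormal_finite[OF B'(2)]
      by (intro prod.mono_neutral_cong_right) auto
    finally show "emeasure (distr std_gaussian (\<Pi>\<^sub>M b\<in>B. borel) (\<lambda>x. \<lambda>b\<in>B. x \<bullet> b)) (Pi\<^sub>E B A) =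
        (\<Prod>b\<in>B. emeasure ?N (A b))" .
  qed
qed

text \<open>The orthogonal projection is described by its characteristic property instead of a basis, because in this
form it visibly commutes with the rotations of \<open>L\<close>.\<close>

definition projects_onto :: "('a::euclidean_space \<Rightarrow> 'a) \<Rightarrow> 'a set \<Rightarrow> bool" where
  "projects_onto p L \<longleftrightarrow> linear p \<and> (\<forall>x. p x \<in> L) \<and> (\<forall>x. \<forall>y\<in>L. (x - p x) \<bullet> y = 0)"

lemma projects_onto_unique:
  assumes p: "projects_onto p L" and L: "subspace L" and z: "z \<in> L" "\<And>y. y \<in> L \<Longrightarrow> (x - z) \<bullet> y = 0"
  shows "p x = z"
proof -
  have "p x - z \<in> L" using p L z by (auto simp: projects_onto_def subspace_diff)
  then have "(x - z) \<bullet> (p x - z) - (x - p x) \<bullet> (p x - z) = 0"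
    using p z by (auto simp: projects_onto_def)
  then have "(p x - z) \<bullet> (p x - z) = 0" by (simp add: inner_diff_left[symmetric])
  then show ?thesis by simp
qed

text \<open>The random coefficients in the definition of the Gaussian measure can be taken to be the coordinates along
the basis of a standard Gaussian vector of the whole space. Their combination is the projection of that vector,
and the choice of the basis disappears.\<close>

lemma subspace_gaussian_projection:
  fixes L :: "(real ^ 'n) set"
  assumes L: "subspace L"
  obtains p where "projects_onto p L" "subspace_gaussian L = distr std_gaussian borel p"
proof -
  let ?N = "density lborel (\<lambda>t. ennreal (std_normal_density t))"
  obtain B where B: "orthonormal B" "span B = L"
      and g: "subspace_gaussian L = distr (\<Pi>\<^sub>M b\<in>B. ?N) borel (\<lambda>g. \<Sum>b\<in>B. g b *\<^sub>R b)"
    using subspace_gaussian_eq[OF L] unfolding orthonormal_def by blast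
  have fin: "finite B" by (rule orthonormal_finite[OF B(1)])
  define p where "p x = (\<Sum>b\<in>B. (x \<bullet> b) *\<^sub>R b)" for x
  have "projects_onto p L"
    unfolding projects_onto_def
  proof (intro conjI allI ballI)
    show "linear p"
      by (rule linearI) (auto simp: p_def algebra_simps scaleR_sum_right sum.distrib)
    show "p x \<in> L" for x
      unfolding p_def B(2)[symmetric] by (intro span_sum span_scale span_base)
    fix x y assume y: "y \<in> L"
    have "p x \<bullet> y = x \<bullet> (\<Sum>b\<in>B. (y \<bullet> b) *\<^sub>R b)"
      by (auto simp: p_def inner_sum_left inner_sum_right inner_commute mult.commute intro!: sum.cong)
    also have "(\<Sum>b\<in>B. (y \<bullet> b) *\<^sub>R b) = y"
      using B fin y by (intro orthonormal_basis_expand) (auto simp: orthonormal_def)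
    finally show "(x - p x) \<bullet> y = 0" by (simp add: inner_diff_left)
  qed
  moreover have "subspace_gaussian L = distr std_gaussian borel p"
  proof -
    have m: "(\<lambda>x::real^'n. \<lambda>b\<in>B. x \<bullet> b) \<in> measurable std_gaussian (\<Pi>\<^sub>M b\<in>B. borel)"
      by (rule measurable_restrict) simp
    have m': "(\<lambda>g. \<Sum>b\<in>B. g b *\<^sub>R b) \<in> measurable (\<Pi>\<^sub>M b\<in>B. borel) borel"
      by measurable
    have "subspace_gaussian L =
        distr (distr std_gaussian (\<Pi>\<^sub>M b\<in>B. borel) (\<lambda>x. \<lambda>b\<in>B. x \<bullet> b)) borel (\<lambda>g. \<Sum>b\<in>B. g b *\<^sub>R b)"
      unfolding g std_gaussian_coordinates[OF B(1)] ..
    also have "\<dots> = distr std_gaussian borel p"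
      by (subst distr_distr[OF m' m]) (auto simp: p_def comp_def fun_eq_iff intro!: arg_cong[where f="distr _ _"])
    finally show ?thesis .
  qed
  ultimately show ?thesis using that by blast
qed

lemma projects_onto_borel:
  "projects_onto p L \<Longrightarrow> p \<in> borel_measurable borel" for L :: "'a::euclidean_space set"
  unfolding projects_onto_def
  by (intro borel_measurable_continuous_onI linear_continuous_on) (simp add: linear_conv_bounded_linear)

lemma sets_subspace_gaussian [simp]: "subspace L \<Longrightarrow> sets (subspace_gaussian L) = sets borel"
  by (metis sets_distr subspace_gaussian_projection)

lemma space_subspace_gaussian [simp]: "subspace L \<Longrightarrow> space (subspace_gaussian L) = UNIV"
  by (metis space_distr space_borel subspace_gaussian_projection)

lemma prob_space_subspace_gaussian: "subspace L \<Longrightarrow> prob_space (subspace_gaussian L)"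
proof -
  assume "subspace L"
  then obtain p where p: "projects_onto p L" "subspace_gaussian L = distr std_gaussian borel p"
    by (rule subspace_gaussian_projection)
  have "p \<in> borel_measurable std_gaussian" using projects_onto_borel[OF p(1)] by simp
  then show ?thesis unfolding p(2) by (rule prob_space.prob_space_distr[OF prob_space_std_gaussian])
qed

lemma subspace_gaussian_concentrated:
  fixes L :: "(real ^ 'n) set"
  assumes L: "subspace L"
  shows "AE x in subspace_gaussian L. x \<in> L"
proof -
  obtain p where p: "projects_onto p L" "subspace_gaussian L = distr std_gaussian borel p"
    using subspace_gaussian_projection[OF L] .
  have [measurable]: "p \<in> borel_measurable borel" by (rule projects_onto_borel[OF p(1)])
  have [measurable]: "L \<in> sets borel" using closed_subspace[OF L] by auto
  show ?thesis unfolding p(2) using p(1)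
    by (subst AE_distr_iff) (auto simp: projects_onto_def)
qed

lemma subspace_gaussian_invariant:
  fixes L :: "(real ^ 'n) set"
  assumes L: "subspace L" and Q: "orthogonal_transformation Q" "Q ` L = L" and A: "A \<in> sets borel"
  shows "emeasure (subspace_gaussian L) (Q -` A) = emeasure (subspace_gaussian L) A"
proof -
  obtain p where p: "projects_onto p L" "subspace_gaussian L = distr std_gaussian borel p"
    using subspace_gaussian_projection[OF L] .
  have [measurable]: "p \<in> borel_measurable borel" by (rule projects_onto_borel[OF p(1)])
  note [measurable] = A orthogonal_transformation_borel[OF Q(1)]
  have comm: "p (Q x) = Q (p x)" for x
  proof (rule projects_onto_unique[OF p(1) L])
    show "Q (p x) \<in> L" using p(1) Q(2) by (auto simp: projects_onto_def)
    fix y assume "y \<in> L"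
    then obtain z where z: "z \<in> L" "y = Q z" using Q(2) by blast
    have "(Q x - Q (p x)) \<bullet> y = Q (x - p x) \<bullet> Q z"
      using orthogonal_transformation_linear[OF Q(1)] z by (simp add: linear_diff)
    also have "\<dots> = (x - p x) \<bullet> z" using Q(1) by (simp add: orthogonal_transformation_def)
    finally show "(Q x - Q (p x)) \<bullet> y = 0" using p(1) z by (simp add: projects_onto_def)
  qed
  have "Q -` A \<in> sets borel" "p -` A \<in> sets borel"
    using measurable_sets[OF orthogonal_transformation_borel[OF Q(1)] A]
      measurable_sets[OF projects_onto_borel[OF p(1)] A] by simp_all
  then have "emeasure (subspace_gaussian L) (Q -` A) = emeasure std_gaussian {x. p (Q x) \<in> A}"
    unfolding p(2) by (subst emeasure_distr) (auto simp: vimage_def comm)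
  also have "\<dots> = emeasure (distr std_gaussian borel Q) (p -` A)"
    using \<open>p -` A \<in> sets borel\<close> by (subst emeasure_distr) (auto simp: vimage_def)
  also have "\<dots> = emeasure (subspace_gaussian L) A"
    unfolding p(2) distr_std_gaussian_orthogonal[OF Q(1)] using A by (subst emeasure_distr) auto
  finally show ?thesis .
qed

text \<open>The preimage of \<open>H\<close> under the projection onto \<open>L\<close> is a proper subspace of the whole space, and the standard
Gaussian measure has a Lebesgue density.\<close>

lemma subspace_gaussian_null:
  fixes L :: "(real ^ 'n) set"
  assumes L: "subspace L" and H: "subspace H" "\<not> L \<subseteq> H"
  shows "H \<in> null_sets (subspace_gaussian L)"
proof -
  obtain p where p: "projects_onto p L" "subspace_gaussian L = distr std_gaussian borel p"
    using subspace_gaussian_projection[OF L] .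
  have [measurable]: "p \<in> borel_measurable borel" by (rule projects_onto_borel[OF p(1)])
  have lin: "linear p" using p(1) by (simp add: projects_onto_def)
  have Hb: "H \<in> sets borel" using closed_subspace[OF H(1)] by auto
  have S: "subspace (p -` H)" by (rule linear_subspace_vimage[OF lin H(1)])
  obtain y where y: "y \<in> L" "y \<notin> H" using H by blast
  have "p y = y" by (rule projects_onto_unique[OF p(1) L y(1)]) simp
  then have "y \<notin> p -` H" using y by simp
  then have "p -` H \<noteq> UNIV" by blast
  then have "dim (p -` H) < DIM(real ^ 'n)"
    using S by (metis dim_eq_full dim_subset_UNIV le_neq_implies_less span_eq_iff)
  then have "negligible (p -` H)" by (rule negligible_lowdim)
  then have "p -` H \<in> null_sets (completion lborel)" by (simp add: negligible_iff_null_sets)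
  moreover have b: "p -` H \<in> sets borel"
    using measurable_sets[OF projects_onto_borel[OF p(1)] Hb] by simp
  ultimately have "p -` H \<in> null_sets lborel" by (simp add: null_sets_completion_iff)
  then have "p -` H \<in> null_sets std_gaussian"
    unfolding std_gaussian_def by (subst null_sets_density_iff) (auto dest: AE_not_in)
  then show ?thesis
    unfolding p(2) using Hb by (subst null_sets_distr_iff) auto
qed

section \<open>Rotation-invariant signed measures on a sphere\<close>

text \<open>The reflection in the hyperplane orthogonal to \<open>x - y\<close>; as \<open>x - y\<close> lies in \<open>L\<close>, it maps \<open>L\<close> to itself.\<close>

lemma reflection_exchanging:
  fixes L :: "'a::euclidean_space set"
  assumes L: "subspace L" and x: "x \<in> L" "y \<in> L" "norm x = norm y"
  obtains Q where "orthogonal_transformation Q" "Q ` L = L" "Q x = y"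
proof -
  define u where "u = x - y"
  define Q where "Q v = v - (2 * (v \<bullet> u) / (u \<bullet> u)) *\<^sub>R u" for v
  have lin: "linear Q"
    by (rule linearI) (auto simp: Q_def algebra_simps add_divide_distrib)
  have uu: "u = 0 \<or> u \<bullet> u \<noteq> 0" by simp
  have "Q v \<bullet> Q w = v \<bullet> w" for v w
    using uu by (auto simp: Q_def inner_diff_left inner_diff_right inner_commute field_simps)
  then have orth: "orthogonal_transformation Q"
    using lin by (simp add: orthogonal_transformation_def)
  have QL: "Q v \<in> L" if "v \<in> L" for v
    using that x L by (auto simp: Q_def u_def intro!: subspace_diff subspace_scale)
  \<comment> \<open>A reflection is its own inverse; this gives \<open>L \<subseteq> Q ` L\<close>.\<close>
  have QQ: "Q (Q v) = v" for v
  proof -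
    have "Q v \<bullet> u = - (v \<bullet> u)" using uu by (auto simp: Q_def inner_diff_left)
    then show ?thesis by (simp add: Q_def[of "Q v"]) (simp add: Q_def)
  qed
  have "Q ` L = L" using QL QQ by (metis image_subset_iff subsetI subset_antisym image_eqI)
  moreover have "Q x = y"
  proof -
    have "u \<bullet> u = 2 * (x \<bullet> u)"
      using x(3) by (simp add: u_def inner_diff_left inner_diff_right inner_commute norm_eq)
    then show ?thesis using uu by (auto simp: Q_def u_def)
  qed
  ultimately show ?thesis using that orth by blast
qed

definition unit_sphere_in :: "'a::euclidean_space set \<Rightarrow> 'a set" where
  "unit_sphere_in L = {x \<in> L. norm x = 1}"

lemma compact_unit_sphere_in: "subspace L \<Longrightarrow> compact (unit_sphere_in L)"
proof -
  assume "subspace L"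
  have "unit_sphere_in L = L \<inter> sphere 0 1" by (auto simp: unit_sphere_in_def)
  then show ?thesis
    using closed_subspace[OF \<open>subspace L\<close>] by (simp add: closed_Int_compact)
qed

text \<open>The values are left polymorphic so that the notion covers both extended nonnegative and signed measures.\<close>

definition invariant_under :: "('a::euclidean_space set \<Rightarrow> 'b) \<Rightarrow> 'a set \<Rightarrow> bool" where
  "invariant_under f L \<longleftrightarrow>
     (\<forall>Q A. orthogonal_transformation Q \<longrightarrow> Q ` L = L \<longrightarrow> A \<in> sets borel \<longrightarrow> f (Q -` A) = f A)"

lemma invariant_underD:
  assumes "invariant_under f L" "orthogonal_transformation Q" "Q ` L = L" "A \<in> sets borel"
  shows "f (Q -` A) = f A"
  using assms by (simp add: invariant_under_def)

lemma invariant_ball: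
  assumes N: "invariant_under (emeasure N) L" and L: "subspace L"
    and x: "x \<in> unit_sphere_in L" "y \<in> unit_sphere_in L"
  shows "emeasure N (ball x r) = emeasure N (ball y r)"
proof -
  obtain Q where Q: "orthogonal_transformation Q" "Q ` L = L" "Q x = y"
    using reflection_exchanging[OF L, of x y] x unfolding unit_sphere_in_def by auto
  have "emeasure N (Q -` ball y r) = emeasure N (ball y r)"
    by (rule invariant_underD[OF N Q(1,2)]) simp
  then show ?thesis
    using orthogonal_transformation_vimage_ball[OF Q(1), of x r] Q(3) by simp
qed

text \<open>Reflections act transitively on the sphere, so each of the measures is uniformly distributed on it.
Compactness makes the ball masses positive, and double counting on the whole space determines their ratio
as the ratio of the total masses.\<close>

lemma invariant_sphere_measure_unique:
  fixes \<mu> \<sigma> :: "'a::euclidean_space measure"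
  assumes L: "subspace L" and sets: "sets \<mu> = sets borel" "sets \<sigma> = sets borel"
    and fin: "finite_measure \<mu>" "prob_space \<sigma>"
    and conc: "AE x in \<mu>. x \<in> unit_sphere_in L" "AE x in \<sigma>. x \<in> unit_sphere_in L"
    and inv: "invariant_under (emeasure \<mu>) L" "invariant_under (emeasure \<sigma>) L"
    and A: "A \<in> sets borel"
  shows "emeasure \<mu> A = emeasure \<mu> UNIV * emeasure \<sigma> A"
proof (cases "emeasure \<mu> UNIV = 0")
  case True
  then have "emeasure \<mu> A = 0" using emeasure_mono[of A UNIV \<mu>] sets by simp
  then show ?thesis using True by simp
next
  case False
  interpret M: finite_measure \<mu> by fact
  interpret S: prob_space \<sigma> by fact
  have sp: "space \<mu> = UNIV" "space \<sigma> = UNIV" using sets[THEN sets_eq_imp_space_eq] by auto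
  have "unit_sphere_in L \<noteq> {}"
  proof
    assume "unit_sphere_in L = {}"
    then have "AE x in \<sigma>. False" using conc(2) by simp
    then show False using S.AE_False by simp
  qed
  then obtain x0 where x0: "x0 \<in> unit_sphere_in L" by blast
  define c where "c r = emeasure \<sigma> (ball x0 r)" for r
  have cm: "AE x in \<mu>. emeasure \<sigma> (ball x r) = c r" for r
    using conc(1) invariant_ball[OF inv(2) L _ x0] by (auto simp: c_def elim!: eventually_mono)
  have cs: "AE x in \<sigma>. emeasure \<mu> (ball x r) = emeasure \<mu> (ball x0 r)" for r
    using conc(2) invariant_ball[OF inv(1) L _ x0] by (auto elim!: eventually_mono)
  have c0: "c r \<noteq> 0" if r: "0 < r" for r
  proof
    assume c: "c r = 0"
    obtain T where T: "T \<subseteq> unit_sphere_in L" "finite T" "unit_sphere_in L \<subseteq> (\<Union>x\<in>T. ball x r)"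
      using compactE_image[OF compact_unit_sphere_in[OF L], of "unit_sphere_in L" "\<lambda>x. ball x r"] r
      by force
    have "ball x r \<in> null_sets \<sigma>" if "x \<in> T" for x
    proof (rule null_setsI)
      have "x \<in> unit_sphere_in L" using that T(1) by blast
      then show "emeasure \<sigma> (ball x r) = 0"
        using c invariant_ball[OF inv(2) L _ x0] by (simp add: c_def)
    qed (simp add: sets)
    then have "(\<Union>x\<in>T. ball x r) \<in> null_sets \<sigma>"
      using T(2) by (intro null_sets_UN') (auto intro: countable_finite)
    then have "AE x in \<sigma>. x \<notin> (\<Union>x\<in>T. ball x r)" by (rule AE_not_in)
    with conc(2) have "AE x in \<sigma>. False"
      by eventually_elim (use T(3) in blast)
    then show False using S.AE_False by simp
  qed
  have ratio: "emeasure \<mu> (ball x0 r) = emeasure \<mu> UNIV * c r" for r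
  proof -
    have "(\<integral>\<^sup>+x. c r \<partial>\<mu>) = (\<integral>\<^sup>+x\<in>UNIV. emeasure \<sigma> (ball x r \<inter> UNIV) \<partial>\<mu>)"
      using cm[of r] by (intro nn_integral_cong_AE) auto
    also have "\<dots> = (\<integral>\<^sup>+y\<in>UNIV. emeasure \<mu> (ball y r \<inter> UNIV) \<partial>\<sigma>)"
      by (intro ball_double_counting sets M.sigma_finite_measure_axioms S.sigma_finite_measure_axioms) auto
    also have "\<dots> = (\<integral>\<^sup>+y. emeasure \<mu> (ball x0 r) \<partial>\<sigma>)"
      using cs[of r] by (intro nn_integral_cong_AE) auto
    finally show ?thesis using S.emeasure_space_1 by (simp add: sp mult.commute)
  qed
  show ?thesis
  proof (rule uniformly_distributed_unique[OF sets, where c=c])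
    show "AE y in \<sigma>. emeasure \<mu> (ball y r) = emeasure \<mu> UNIV * c r" for r
      using cs[of r] unfolding ratio .
  qed (use cm c0 False A in \<open>auto simp: c_def less_top[symmetric]\<close>)
qed

lemma orthogonal_inverse:
  fixes L :: "'a::euclidean_space set"
  assumes Q: "orthogonal_transformation Q" "Q ` L = L"
  obtains R where "orthogonal_transformation R" "R ` L = L" "\<And>x. R (Q x) = x" "\<And>x. Q (R x) = x"
proof
  have b: "bij Q" by (rule orthogonal_transformation_bij[OF Q(1)])
  show "orthogonal_transformation (inv Q)" by (rule orthogonal_transformation_inv[OF Q(1)])
  show RQ: "inv Q (Q x) = x" for x using b by (simp add: bij_is_inj)
  show "Q (inv Q x) = x" for x using b by (simp add: bij_is_surj surj_f_inv_f)
  have "inv Q ` L = inv Q ` (Q ` L)" by (simp only: Q(2))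
  also have "\<dots> = L" by (simp add: image_image RQ)
  finally show "inv Q ` L = L" .
qed

lemma vimage_orthogonal_borel:
  fixes Q :: "'a::euclidean_space \<Rightarrow> 'a"
  assumes "orthogonal_transformation Q" "A \<in> sets borel"
  shows "Q -` A \<in> sets borel"
  using measurable_sets[OF orthogonal_transformation_borel] assms by fastforce

text \<open>A rotation permutes the sets over which the supremum is taken.\<close>

lemma upper_variation_invariant:
  assumes \<nu>: "countably_additive_signed borel \<nu>" and inv: "invariant_under \<nu> L"
  shows "invariant_under (upper_variation borel \<nu>) L"
proof -
  have le: "upper_variation borel \<nu> (Q -` A) \<le> upper_variation borel \<nu> A"
    if Q: "orthogonal_transformation Q" "Q ` L = L" and A: "A \<in> sets borel" for Q A
  proof (rule upper_variation_least)
    obtain R where R: "orthogonal_transformation R" "R ` L = L" "\<And>x. R (Q x) = x" "\<And>x. Q (R x) = x"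
      using orthogonal_inverse[OF Q] by blast
    fix B assume B: "B \<in> sets borel" "B \<subseteq> Q -` A"
    have "R -` B \<subseteq> A" using B(2) R(4) by (metis subsetI subsetD vimageE vimageI vimage_eq)
    then have "\<nu> (R -` B) \<le> upper_variation borel \<nu> A"
      by (intro upper_variation_upper[OF \<nu>] vimage_orthogonal_borel R B)
    moreover have "\<nu> (R -` B) = \<nu> B" by (rule invariant_underD[OF inv R(1,2) B(1)])
    ultimately show "\<nu> B \<le> upper_variation borel \<nu> A" by simp
  qed
  show ?thesis
    unfolding invariant_under_def
  proof (intro allI impI antisym)
    fix Q :: "'a \<Rightarrow> 'a" and A :: "'a set"
    assume Q: "orthogonal_transformation Q" "Q ` L = L" and A: "A \<in> sets borel"
    show "upper_variation borel \<nu> (Q -` A) \<le> upper_variation borel \<nu> A" by (rule le[OF Q A])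
    obtain R where R: "orthogonal_transformation R" "R ` L = L" "\<And>x. R (Q x) = x" "\<And>x. Q (R x) = x"
      using orthogonal_inverse[OF Q] by blast
    have "A = R -` (Q -` A)" using R(4) by auto
    then show "upper_variation borel \<nu> A \<le> upper_variation borel \<nu> (Q -` A)"
      using le[OF R(1,2) vimage_orthogonal_borel[OF Q(1) A]] by simp
  qed
qed

lemma upper_variation_multiple:
  fixes \<sigma> :: "'a::euclidean_space measure"
  assumes L: "subspace L" and \<sigma>: "sets \<sigma> = sets borel" "prob_space \<sigma>"
      "AE x in \<sigma>. x \<in> unit_sphere_in L" "invariant_under (emeasure \<sigma>) L"
    and \<nu>: "countably_additive_signed borel \<nu>" "invariant_under \<nu> L"
      "\<And>B. B \<in> sets borel \<Longrightarrow> \<nu> B = \<nu> (B \<inter> unit_sphere_in L)"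
    and A: "A \<in> sets borel"
  shows "upper_variation borel \<nu> A = upper_variation borel \<nu> UNIV * measure \<sigma> A"
proof -
  obtain \<mu> where \<mu>: "sets \<mu> = sets borel" "finite_measure \<mu>"
      "\<And>A. A \<in> sets borel \<Longrightarrow> measure \<mu> A = upper_variation borel \<nu> A"
    using upper_variation_measure[OF \<nu>(1)] by blast
  interpret M: finite_measure \<mu> by fact
  interpret S: prob_space \<sigma> by fact
  have S: "unit_sphere_in L \<in> sets borel"
    using compact_unit_sphere_in[OF L] by (simp add: borel_compact)
  have "upper_variation borel \<nu> (- unit_sphere_in L) \<le> 0"
  proof (rule upper_variation_least)
    fix B assume B: "B \<in> sets borel" "B \<subseteq> - unit_sphere_in L"
    then have "B \<inter> unit_sphere_in L = {}" by blast
    then show "\<nu> B \<le> 0" using \<nu>(3)[OF B(1)] signed_empty[OF \<nu>(1)] by simp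
  qed
  then have "measure \<mu> (- unit_sphere_in L) = 0"
    using \<mu>(3)[of "- unit_sphere_in L"] S measure_nonneg[of \<mu> "- unit_sphere_in L"] by auto
  then have "- unit_sphere_in L \<in> null_sets \<mu>"
    using S \<mu>(1) by (auto simp: M.emeasure_eq_measure)
  \<comment> \<open>The upper variation lives on the sphere because \<open>\<nu>\<close> vanishes on all sets that miss it.\<close>
  then have conc: "AE x in \<mu>. x \<in> unit_sphere_in L" by (auto dest: AE_not_in)
  have inv: "invariant_under (emeasure \<mu>) L"
    unfolding invariant_under_def
  proof (intro allI impI)
    fix Q :: "'a \<Rightarrow> 'a" and A :: "'a set"
    assume Q: "orthogonal_transformation Q" "Q ` L = L" and A: "A \<in> sets borel"
    then show "emeasure \<mu> (Q -` A) = emeasure \<mu> A"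
      using upper_variation_invariant[OF \<nu>(1,2)] vimage_orthogonal_borel[OF Q(1) A]
      unfolding invariant_under_def by (simp add: M.emeasure_eq_measure \<mu>(3))
  qed
  have "emeasure \<mu> A = emeasure \<mu> UNIV * emeasure \<sigma> A"
    by (rule invariant_sphere_measure_unique[OF L \<mu>(1) \<sigma>(1) \<mu>(2) \<sigma>(2) conc \<sigma>(3) inv \<sigma>(4) A])
  then have "measure \<mu> A = measure \<mu> UNIV * measure \<sigma> A"
    by (simp add: M.emeasure_eq_measure S.emeasure_eq_measure ennreal_mult[symmetric])
  then show ?thesis using A by (simp add: \<mu>(3))
qed

lemma invariant_signed_sphere_measure:
  fixes \<sigma> :: "'a::euclidean_space measure"
  assumes L: "subspace L" and \<sigma>: "sets \<sigma> = sets borel" "prob_space \<sigma>"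
      "AE x in \<sigma>. x \<in> unit_sphere_in L" "invariant_under (emeasure \<sigma>) L"
    and \<nu>: "countably_additive_signed borel \<nu>" "invariant_under \<nu> L"
      "\<And>B. B \<in> sets borel \<Longrightarrow> \<nu> B = \<nu> (B \<inter> unit_sphere_in L)"
    and A: "A \<in> sets borel"
  shows "\<nu> A = \<nu> UNIV * measure \<sigma> A"
proof -
  let ?V = "upper_variation borel \<nu>" and ?W = "upper_variation borel (\<lambda>A. - \<nu> A)"
  have V: "?V A = ?V UNIV * measure \<sigma> A"
    by (rule upper_variation_multiple[OF L \<sigma> \<nu> A])
  have W: "?W A = ?W UNIV * measure \<sigma> A"
  proof (rule upper_variation_multiple[OF L \<sigma> signed_uminus[OF \<nu>(1)] _ _ A])
    show "invariant_under (\<lambda>A. - \<nu> A) L" using \<nu>(2) by (simp add: invariant_under_def)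
    show "- \<nu> B = - \<nu> (B \<inter> unit_sphere_in L)" if "B \<in> sets borel" for B
      using \<nu>(3)[OF that] by simp
  qed
  have "\<nu> A = ?V A - ?W A" by (rule jordan_decomposition[OF \<nu>(1) A])
  also have "\<dots> = (?V UNIV - ?W UNIV) * measure \<sigma> A" by (simp only: V W left_diff_distrib)
  also have "?V UNIV - ?W UNIV = \<nu> UNIV" using jordan_decomposition[OF \<nu>(1), of UNIV] by simp
  finally show ?thesis .
qed

section \<open>Conic sets and rotation-invariant conic measures\<close>

lemma conic_sets_iff:
  "M \<in> conic_sets \<longleftrightarrow> M \<in> sets borel \<and> (\<forall>c>0. \<forall>x\<in>M. c *\<^sub>R x \<in> M)"
proof -
  have "(\<lambda>x. c *\<^sub>R x) ` M = M"
    if M: "\<forall>c>0. \<forall>x\<in>M. c *\<^sub>R x \<in> M" and c: "0 < c" for c :: real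
  proof
    show "(\<lambda>x. c *\<^sub>R x) ` M \<subseteq> M" using M c by blast
    show "M \<subseteq> (\<lambda>x. c *\<^sub>R x) ` M"
    proof
      fix x assume "x \<in> M"
      then have "(1 / c) *\<^sub>R x \<in> M" using M c by simp
      then show "x \<in> (\<lambda>x. c *\<^sub>R x) ` M" using c by (intro image_eqI[of _ _ "(1 / c) *\<^sub>R x"]) auto
    qed
  qed
  then show ?thesis unfolding conic_sets_def by blast
qed

lemma conic_sets_scale:
  assumes "M \<in> conic_sets" "0 < c"
  shows "c *\<^sub>R x \<in> M \<longleftrightarrow> x \<in> M"
proof
  assume "c *\<^sub>R x \<in> M"
  then have "(1 / c) *\<^sub>R (c *\<^sub>R x) \<in> M"
    using assms unfolding conic_sets_iff by (meson zero_less_divide_1_iff)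
  then show "x \<in> M" using assms by simp
qed (use assms in \<open>simp add: conic_sets_iff\<close>)

text \<open>The conic sets become the measurable sets of a measure space, so that conic measures are signed measures in
the sense above.\<close>

definition conic_algebra :: "(real ^ 'n) measure" where
  "conic_algebra = sigma UNIV conic_sets"

lemma sets_conic_algebra: "sets conic_algebra = (conic_sets :: (real ^ 'n) set set)"
proof -
  have "sigma_algebra UNIV (conic_sets :: (real ^ 'n) set set)"
    unfolding sigma_algebra_iff2
  proof (intro conjI ballI allI impI)
    show "UNIV - M \<in> conic_sets" if "M \<in> conic_sets" for M :: "(real ^ 'n) set"
    proof -
      have "\<forall>c>0. \<forall>x\<in>UNIV - M. c *\<^sub>R x \<in> UNIV - M" using conic_sets_scale[OF that] by blast
      then show ?thesis using that unfolding conic_sets_iff by auto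
    qed
    show "\<Union> (range A) \<in> conic_sets" if "range A \<subseteq> conic_sets" for A :: "nat \<Rightarrow> (real ^ 'n) set"
      using that unfolding conic_sets_iff by (auto simp: image_subset_iff conic_sets_iff)
  qed (auto simp: conic_sets_iff)
  then show ?thesis
    by (simp add: conic_algebra_def sigma_algebra.sigma_sets_eq)
qed

lemma conic_measure_signed: "conic_measure \<phi> \<longleftrightarrow> countably_additive_signed conic_algebra \<phi>"
  by (simp add: conic_measure_def countably_additive_signed_def sets_conic_algebra)

lemma conic_sets_UNIV: "UNIV \<in> conic_sets"
  and conic_sets_singleton: "{0} \<in> conic_sets"
  by (auto simp: conic_sets_iff)

lemma conic_sets_Int: "M \<in> conic_sets \<Longrightarrow> N \<in> conic_sets \<Longrightarrow> M \<inter> N \<in> conic_sets"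
  and conic_sets_Diff: "M \<in> conic_sets \<Longrightarrow> N \<in> conic_sets \<Longrightarrow> M - N \<in> conic_sets"
  for M N :: "(real ^ 'n) set"
  unfolding sets_conic_algebra[symmetric] by auto

lemma conic_sets_subspace: "subspace L \<Longrightarrow> L \<in> conic_sets"
  using closed_subspace[of L] by (auto simp: conic_sets_iff subspace_scale)

text \<open>The conic set of given directions. On conic sets that miss the origin it is inverse to taking the trace on
the unit sphere, and it preserves disjoint unions, so conic measures become measures on directions.\<close>

definition direction_cone :: "'a::euclidean_space set \<Rightarrow> 'a set" where
  "direction_cone B = {x. x \<noteq> 0 \<and> x /\<^sub>R norm x \<in> B}"

lemma direction_scale:
  fixes x :: "'a::euclidean_space"
  assumes "0 < c"
  shows "(c *\<^sub>R x) /\<^sub>R norm (c *\<^sub>R x) = x /\<^sub>R norm x"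
  using assms by (simp add: field_simps)

lemma direction_orthogonal:
  fixes x :: "'a::euclidean_space"
  assumes "orthogonal_transformation Q"
  shows "Q (x /\<^sub>R norm x) = Q x /\<^sub>R norm (Q x)"
  by (simp only: orthogonal_transformation_norm[OF assms] orthogonal_transformation_scaleR[OF assms])

lemma direction_borel [measurable]:
  "(\<lambda>x::'a::euclidean_space. x /\<^sub>R norm x) \<in> borel_measurable borel"
  by measurable

lemma direction_cone_conic:
  fixes B :: "(real ^ 'n) set"
  assumes [measurable]: "B \<in> sets borel"
  shows "direction_cone B \<in> conic_sets"
  unfolding conic_sets_iff
proof (intro conjI allI impI ballI)
  have "{x \<in> space borel. x \<noteq> 0 \<and> x /\<^sub>R norm x \<in> B} \<in> sets borel" by measurable
  then show "direction_cone B \<in> sets borel" by (simp add: direction_cone_def)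
  show "c *\<^sub>R x \<in> direction_cone B" if "0 < c" "x \<in> direction_cone B" for c x
    using that unfolding direction_cone_def mem_Collect_eq direction_scale[OF that(1)] by simp
qed

lemma conic_sets_direction_iff:
  assumes "M \<in> conic_sets"
  shows "x /\<^sub>R norm x \<in> M \<longleftrightarrow> x \<in> M"
  using conic_sets_scale[OF assms, of "inverse (norm x)" x] by (cases "x = 0") auto

lemma direction_cone_of_conic:
  assumes M: "M \<in> conic_sets" "0 \<notin> M"
  shows "direction_cone M = M"
  unfolding direction_cone_def conic_sets_direction_iff[OF M(1)] using M(2) by auto

lemma direction_distribution:
  fixes L :: "(real ^ 'n) set"
  assumes L: "subspace L" "dim L \<noteq> 0"
  defines "\<sigma> \<equiv> distr (subspace_gaussian L) borel (\<lambda>x. x /\<^sub>R norm x)"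
  shows "prob_space \<sigma>" "AE x in \<sigma>. x \<in> unit_sphere_in L" "invariant_under (emeasure \<sigma>) L"
    and "\<And>M. M \<in> conic_sets \<Longrightarrow> 0 \<notin> M \<Longrightarrow> measure \<sigma> M = measure (subspace_gaussian L) M"
proof -
  have d: "(\<lambda>x. x /\<^sub>R norm x) \<in> measurable (subspace_gaussian L) borel"
    using L by (simp add: measurable_cong_sets[of "subspace_gaussian L" borel])
  interpret G: prob_space "subspace_gaussian L" by (rule prob_space_subspace_gaussian[OF L(1)])
  show "prob_space \<sigma>" unfolding \<sigma>_def by (rule G.prob_space_distr[OF d])
  have S: "unit_sphere_in L \<in> sets borel"
    using compact_unit_sphere_in[OF L(1)] by (simp add: borel_compact)
  have "\<not> L \<subseteq> {0}" using L(2) by (simp add: dim_eq_0)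
  then have "{0} \<in> null_sets (subspace_gaussian L)"
    by (intro subspace_gaussian_null L subspace_single_0)
  then have n0: "AE x in subspace_gaussian L. x \<noteq> 0" by (auto dest: AE_not_in)
  show "AE x in \<sigma>. x \<in> unit_sphere_in L"
    unfolding \<sigma>_def
  proof (subst AE_distr_iff[OF d])
    show "{x \<in> space borel. x \<in> unit_sphere_in L} \<in> sets borel" using S by simp
    show "AE x in subspace_gaussian L. x /\<^sub>R norm x \<in> unit_sphere_in L"
      using n0 subspace_gaussian_concentrated[OF L(1)]
      by eventually_elim (use L(1) in \<open>auto simp: unit_sphere_in_def subspace_scale\<close>)
  qed
  have em: "emeasure \<sigma> A = emeasure (subspace_gaussian L) ((\<lambda>x. x /\<^sub>R norm x) -` A)"
    if "A \<in> sets borel" for A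
    unfolding \<sigma>_def using that L d by (subst emeasure_distr) auto
  show "invariant_under (emeasure \<sigma>) L"
    unfolding invariant_under_def
  proof (intro allI impI)
    fix Q :: "real ^ 'n \<Rightarrow> real ^ 'n" and A :: "(real ^ 'n) set"
    assume Q: "orthogonal_transformation Q" "Q ` L = L" and A: "A \<in> sets borel"
    have "(\<lambda>x. x /\<^sub>R norm x) -` (Q -` A) = Q -` ((\<lambda>x. x /\<^sub>R norm x) -` A)"
      unfolding vimage_def mem_Collect_eq direction_orthogonal[OF Q(1)] ..
    moreover have "(\<lambda>x. x /\<^sub>R norm x) -` A \<in> sets borel"
      using measurable_sets[OF direction_borel A] by simp
    ultimately show "emeasure \<sigma> (Q -` A) = emeasure \<sigma> A"
      using subspace_gaussian_invariant[OF L(1) Q]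
      by (simp add: em A vimage_orthogonal_borel[OF Q(1) A])
  qed
  fix M :: "(real ^ 'n) set" assume M: "M \<in> conic_sets" "0 \<notin> M"
  have "(\<lambda>x. x /\<^sub>R norm x) -` M = M"
    unfolding vimage_def conic_sets_direction_iff[OF M(1)] by simp
  moreover have "M \<in> sets borel" using M(1) by (simp add: conic_sets_iff)
  ultimately show "measure \<sigma> M = measure (subspace_gaussian L) M"
    using em[of M] by (simp add: measure_def)
qed

text \<open>Transported to directions, \<open>\<phi>\<close> is a rotation-invariant signed measure on the unit sphere of \<open>L\<close>, and so is the
Gaussian measure.\<close>

lemma invariant_conic_measure:
  fixes L :: "(real ^ 'n) set"
  assumes \<phi>: "conic_measure \<phi>" and L: "subspace L" "dim L \<noteq> 0"
    and loc: "\<And>M. M \<in> conic_sets \<Longrightarrow> \<phi> M = \<phi> (M \<inter> L)"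
    and inv: "\<And>Q M. orthogonal_transformation Q \<Longrightarrow> Q ` L = L \<Longrightarrow> M \<in> conic_sets \<Longrightarrow> \<phi> (Q ` M) = \<phi> M"
    and M: "M \<in> conic_sets" "0 \<notin> M"
  shows "\<phi> M = \<phi> (UNIV - {0}) * measure (subspace_gaussian L) M"
proof -
  let ?\<sigma> = "distr (subspace_gaussian L) borel (\<lambda>x. x /\<^sub>R norm x)"
  define \<nu> where "\<nu> B = \<phi> (direction_cone B)" for B
  have Mb: "M \<in> sets borel" using M(1) by (simp add: conic_sets_iff)
  have "\<nu> M = \<nu> UNIV * measure ?\<sigma> M"
  proof (rule invariant_signed_sphere_measure[OF L(1) _ direction_distribution(1-3)[OF L] _ _ _ Mb])
    show "countably_additive_signed borel \<nu>"
      unfolding countably_additive_signed_def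
    proof (intro allI impI)
      fix A :: "nat \<Rightarrow> (real ^ 'n) set" assume A: "range A \<subseteq> sets borel" "disjoint_family A"
      have "range (\<lambda>i. direction_cone (A i)) \<subseteq> conic_sets"
        using A(1) direction_cone_conic by blast
      moreover have "disjoint_family (\<lambda>i. direction_cone (A i))"
        using A(2) unfolding disjoint_family_on_def direction_cone_def by blast
      ultimately have "(\<lambda>i. \<phi> (direction_cone (A i))) sums \<phi> (\<Union>i. direction_cone (A i))"
        using \<phi> unfolding conic_measure_def by blast
      moreover have "(\<Union>i. direction_cone (A i)) = direction_cone (\<Union>i. A i)"
        by (auto simp: direction_cone_def)
      ultimately show "(\<lambda>i. \<nu> (A i)) sums \<nu> (\<Union>i. A i)" by (simp add: \<nu>_def)
    qed
    show "invariant_under \<nu> L"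
      unfolding invariant_under_def
    proof (intro allI impI)
      fix Q :: "real ^ 'n \<Rightarrow> real ^ 'n" and A :: "(real ^ 'n) set"
      assume Q: "orthogonal_transformation Q" "Q ` L = L" and A: "A \<in> sets borel"
      obtain R where R: "orthogonal_transformation R" "R ` L = L" "\<And>x. R (Q x) = x" "\<And>x. Q (R x) = x"
        using orthogonal_inverse[OF Q] by blast
      have Q0: "Q x = 0 \<longleftrightarrow> x = 0" for x
        using orthogonal_transformation_norm[OF Q(1)] by (metis norm_eq_zero)
      have "direction_cone (Q -` A) = Q -` direction_cone A"
        unfolding direction_cone_def vimage_def mem_Collect_eq direction_orthogonal[OF Q(1)] Q0 ..
      also have "\<dots> = R ` direction_cone A"
        using R(3,4) by (metis (no_types, lifting) image_eqI subsetI subset_antisym vimageE vimageI vimage_eq imageE)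
      finally show "\<nu> (Q -` A) = \<nu> A"
        using inv[OF R(1,2) direction_cone_conic[OF A]] by (simp add: \<nu>_def)
    qed
    fix B :: "(real ^ 'n) set" assume B: "B \<in> sets borel"
    have S: "unit_sphere_in L \<in> sets borel"
      using compact_unit_sphere_in[OF L(1)] by (simp add: borel_compact)
    have "direction_cone B \<inter> L = direction_cone (B \<inter> unit_sphere_in L) \<inter> L"
      using L(1) by (auto simp: direction_cone_def unit_sphere_in_def subspace_scale)
    then show "\<nu> B = \<nu> (B \<inter> unit_sphere_in L)"
      using loc[OF direction_cone_conic[OF B]] loc[OF direction_cone_conic[of "B \<inter> unit_sphere_in L"]] B S
      by (simp add: \<nu>_def)
  qed simp
  moreover have "direction_cone UNIV = UNIV - {0 :: real ^ 'n}" by (auto simp: direction_cone_def)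
  ultimately show ?thesis
    using direction_distribution(4)[OF L M] direction_cone_of_conic[OF M] by (simp add: \<nu>_def)
qed

section \<open>Faces and skeleta of polyhedral cones\<close>

text \<open>The lineality space of the tangent cone of \<open>C\<close> at \<open>x\<close>. For a polyhedral cone it is the span of the smallest
face containing \<open>x\<close>, but it is described here by neither faces nor inequalities, which makes different cones
comparable at the same point.\<close>

definition tangent_lineality :: "'a::real_vector set \<Rightarrow> 'a \<Rightarrow> 'a set" where
  "tangent_lineality C x = {y. \<exists>e>0. x + e *\<^sub>R y \<in> C \<and> x - e *\<^sub>R y \<in> C}"

lemma
  fixes C :: "(real ^ 'n) set"
  assumes "C \<in> polyhedral_cones"
  shows polyhedral_cones_zero: "0 \<in> C"
    and polyhedral_cones_convex: "convex C"
    and polyhedral_cones_scale: "\<And>c x. 0 \<le> c \<Longrightarrow> x \<in> C \<Longrightarrow> c *\<^sub>R x \<in> C"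
    and polyhedral_cones_conic: "C \<in> conic_sets"
proof -
  obtain m :: nat and A :: "nat \<Rightarrow> real ^ 'n" where C: "C = {x. \<forall>i<m. A i \<bullet> x \<le> 0}"
    using assms unfolding polyhedral_cones_def by blast
  have "C = \<Inter> ((\<lambda>i. {x. A i \<bullet> x \<le> 0}) ` {..<m})" using C by auto
  then have P: "polyhedron C"
    by (auto intro!: polyhedron_Inter polyhedron_halfspace_le)
  show "0 \<in> C" by (simp add: C)
  show "convex C" by (rule polyhedron_imp_convex[OF P])
  have cl: "closed C" by (rule polyhedron_imp_closed[OF P])
  show sc: "c *\<^sub>R x \<in> C" if "0 \<le> c" "x \<in> C" for c x
    using that by (simp add: C mult_nonneg_nonpos)
  show "C \<in> conic_sets" using cl sc by (auto simp: conic_sets_iff)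
qed

lemma short_segment_in_ball:
  fixes x y :: "'a::euclidean_space"
  assumes r: "0 < r"
  obtains e where "0 < e" "x + e *\<^sub>R y \<in> ball x r" "x - e *\<^sub>R y \<in> ball x r"
proof
  have p: "0 < norm y + 1" using norm_ge_zero[of y] by linarith
  show e: "0 < r / (2 * (norm y + 1))" using r p by simp
  have "r * norm y < r * (2 * (norm y + 1))"
    using r add_nonneg_pos[OF norm_ge_zero[of y], of 2] by (intro mult_strict_left_mono) auto
  then have "r / (2 * (norm y + 1)) * norm y < r" using p by (simp add: pos_divide_less_eq)
  then show "x + (r / (2 * (norm y + 1))) *\<^sub>R y \<in> ball x r"
    "x - (r / (2 * (norm y + 1))) *\<^sub>R y \<in> ball x r"
    using e r by (auto simp: dist_norm)
qed

text \<open>The constraints that are strict at \<open>x\<close> remain so near \<open>x\<close>, so that only those with equality restrict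
the directions.\<close>

lemma
  fixes A :: "nat \<Rightarrow> 'a::euclidean_space"
  assumes C: "C = {x. \<forall>i<m. A i \<bullet> x \<le> 0}" and x: "x \<in> C"
  shows tangent_lineality_eq:
      "tangent_lineality C x = {y. \<forall>i<m. A i \<bullet> x = 0 \<longrightarrow> A i \<bullet> y = 0}" (is "_ = ?T")
    and ball_Int_tangent_lineality_of_rows: "\<exists>r>0. ball x r \<inter> tangent_lineality C x \<subseteq> C"
proof -
  let ?J = "{i. i < m \<and> A i \<bullet> x \<noteq> 0}"
  have "open (\<Inter>i\<in>?J. {z. A i \<bullet> z < 0})"
    by (intro open_INT ballI open_halfspace_lt) simp
  moreover have "x \<in> (\<Inter>i\<in>?J. {z. A i \<bullet> z < 0})"
    using x by (auto simp: C less_le)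
  ultimately obtain r where r: "0 < r" "ball x r \<subseteq> (\<Inter>i\<in>?J. {z. A i \<bullet> z < 0})"
    using openE by blast
  have sub: "ball x r \<inter> ?T \<subseteq> C"
  proof
    fix z assume z: "z \<in> ball x r \<inter> ?T"
    have "A i \<bullet> z \<le> 0" if "i < m" for i
    proof (cases "A i \<bullet> x = 0")
      case True
      then show ?thesis using z that by simp
    next
      case False
      then have "z \<in> {z. A i \<bullet> z < 0}" using r z that by blast
      then show ?thesis by simp
    qed
    then show "z \<in> C" by (simp add: C)
  qed
  show T: "tangent_lineality C x = ?T"
  proof
    show "tangent_lineality C x \<subseteq> ?T"
    proof
      fix y assume "y \<in> tangent_lineality C x"
      then obtain e where e: "0 < e" "x + e *\<^sub>R y \<in> C" "x - e *\<^sub>R y \<in> C"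
        unfolding tangent_lineality_def by blast
      have "A i \<bullet> y = 0" if "i < m" "A i \<bullet> x = 0" for i
      proof -
        have "e * (A i \<bullet> y) \<le> 0" "- (e * (A i \<bullet> y)) \<le> 0"
          using e that by (auto simp: C inner_add_right inner_diff_right)
        then show ?thesis using e(1) by auto
      qed
      then show "y \<in> ?T" by simp
    qed
    show "?T \<subseteq> tangent_lineality C x"
    proof
      fix y assume y: "y \<in> ?T"
      obtain e where e: "0 < e" "x + e *\<^sub>R y \<in> ball x r" "x - e *\<^sub>R y \<in> ball x r"
        using short_segment_in_ball[OF r(1)] .
      have "x + e *\<^sub>R y \<in> ?T" "x - e *\<^sub>R y \<in> ?T"
        using y by (auto simp: inner_add_right inner_diff_right)
      then show "y \<in> tangent_lineality C x"
        using e sub unfolding tangent_lineality_def by blast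
    qed
  qed
  show "\<exists>r>0. ball x r \<inter> tangent_lineality C x \<subseteq> C"
    using r(1) sub unfolding T by blast
qed

lemma
  fixes C :: "(real ^ 'n) set"
  assumes C: "C \<in> polyhedral_cones" and x: "x \<in> C"
  shows subspace_tangent_lineality: "subspace (tangent_lineality C x)"
    and mem_tangent_lineality: "x \<in> tangent_lineality C x"
    and tangent_lineality_scale:
      "0 < c \<Longrightarrow> tangent_lineality C (c *\<^sub>R x) = tangent_lineality C x"
    and ball_Int_tangent_lineality_subset: "\<exists>r>0. ball x r \<inter> tangent_lineality C x \<subseteq> C"
proof -
  obtain m :: nat and A :: "nat \<Rightarrow> real ^ 'n" where A: "C = {x. \<forall>i<m. A i \<bullet> x \<le> 0}"
    using C unfolding polyhedral_cones_def by blast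
  note T = tangent_lineality_eq[OF A] ball_Int_tangent_lineality_of_rows[OF A]
  show "subspace (tangent_lineality C x)"
    unfolding T(1)[OF x] by (auto simp: subspace_def inner_add_right)
  show "x \<in> tangent_lineality C x" unfolding T(1)[OF x] by simp
  show "\<exists>r>0. ball x r \<inter> tangent_lineality C x \<subseteq> C" by (rule T(2)[OF x])
  assume c: "0 < c"
  then have "c *\<^sub>R x \<in> C" using polyhedral_cones_scale[OF C] x by simp
  then show "tangent_lineality C (c *\<^sub>R x) = tangent_lineality C x"
    using T(1) x c by simp
qed

text \<open>The sum of the rows that vanish at \<open>x\<close> is the normal vector that exposes the smallest face containing \<open>x\<close>.\<close>

lemma tangent_lineality_face_span:
  fixes C :: "(real ^ 'n) set"
  assumes C: "C \<in> polyhedral_cones" and x: "x \<in> C"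
  shows "tangent_lineality C x \<in> face_spans (dim (tangent_lineality C x)) C"
proof -
  obtain m :: nat and A :: "nat \<Rightarrow> real ^ 'n" where A: "C = {x. \<forall>i<m. A i \<bullet> x \<le> 0}"
    using C unfolding polyhedral_cones_def by blast
  let ?I = "{i. i < m \<and> A i \<bullet> x = 0}" and ?T = "tangent_lineality C x"
  have T: "?T = {y. \<forall>i\<in>?I. A i \<bullet> y = 0}" using tangent_lineality_eq[OF A x] by auto
  have T_sub: "subspace ?T" and xT: "x \<in> ?T" using subspace_tangent_lineality[OF C x] mem_tangent_lineality[OF C x] by blast+
  define z where "z = (\<Sum>i\<in>?I. A i)"
  have yz: "y \<bullet> z = (\<Sum>i\<in>?I. A i \<bullet> y)" for y
    by (simp add: z_def inner_sum_right inner_commute)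
  have le: "A i \<bullet> y \<le> 0" if "y \<in> C" "i \<in> ?I" for y i using that by (simp add: A)
  have "y \<bullet> z \<le> 0" if "y \<in> C" for y
    unfolding yz by (rule sum_nonpos) (rule le[OF that])
  moreover have "y \<bullet> z = 0 \<longleftrightarrow> y \<in> ?T" if "y \<in> C" for y
  proof -
    have "y \<bullet> z = 0 \<longleftrightarrow> (\<Sum>i\<in>?I. - (A i \<bullet> y)) = 0" by (simp add: yz sum_negf)
    also have "\<dots> \<longleftrightarrow> (\<forall>i\<in>?I. - (A i \<bullet> y) = 0)"
      by (rule sum_nonneg_eq_0_iff) (use le[OF that] in auto)
    finally show ?thesis unfolding T by simp
  qed
  ultimately have F: "C \<inter> ?T \<in> cone_faces C"
    unfolding cone_faces_def mem_Collect_eq by (intro exI[of _ z]) auto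
  have "span (C \<inter> ?T) = ?T"
  proof
    show "span (C \<inter> ?T) \<subseteq> ?T" using T_sub by (simp add: span_minimal)
    show "?T \<subseteq> span (C \<inter> ?T)"
    proof
      fix y assume y: "y \<in> ?T"
      then obtain e where e: "0 < e" "x + e *\<^sub>R y \<in> C" unfolding tangent_lineality_def by blast
      have "x + e *\<^sub>R y \<in> ?T" using T_sub xT y by (simp add: subspace_add subspace_scale)
      then have "(x + e *\<^sub>R y) - x \<in> span (C \<inter> ?T)"
        using e x xT by (intro span_diff span_base) auto
      then have "(1 / e) *\<^sub>R ((x + e *\<^sub>R y) - x) \<in> span (C \<inter> ?T)" by (rule span_scale)
      then show "y \<in> span (C \<inter> ?T)" using e by simp
    qed
  qed
  then show ?thesis using F unfolding face_spans_def by (intro CollectI bexI[of _ "C \<inter> ?T"]) auto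
qed

lemma cone_face_Int_span:
  assumes "F \<in> cone_faces C"
  shows "C \<inter> span F = F"
proof -
  obtain z where z: "F = {x \<in> C. x \<bullet> z = 0}" using assms unfolding cone_faces_def by blast
  have "span F \<subseteq> {x. z \<bullet> x = 0}"
    by (rule span_minimal[OF _ subspace_hyperplane]) (auto simp: z inner_commute)
  then show ?thesis using span_superset[of F] by (auto simp: z inner_commute)
qed

lemma tangent_lineality_subset_face_span:
  assumes F: "F \<in> cone_faces C" and x: "x \<in> F"
  shows "tangent_lineality C x \<subseteq> span F"
proof
  obtain z where z: "\<And>x. x \<in> C \<Longrightarrow> x \<bullet> z \<le> 0" "F = {x \<in> C. x \<bullet> z = 0}"
    using F unfolding cone_faces_def by blast
  fix y assume "y \<in> tangent_lineality C x"
  then obtain e where e: "0 < e" "x + e *\<^sub>R y \<in> C" "x - e *\<^sub>R y \<in> C"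
    unfolding tangent_lineality_def by blast
  have "(x + e *\<^sub>R y) \<bullet> z = 0"
    using z(1)[OF e(2)] z(1)[OF e(3)] x z(2) by (simp add: inner_add_left inner_diff_left)
  then have "x + e *\<^sub>R y \<in> F" using e z(2) by simp
  then have "(x + e *\<^sub>R y) - x \<in> span F" using x by (intro span_diff span_base)
  then have "(1 / e) *\<^sub>R ((x + e *\<^sub>R y) - x) \<in> span F" by (rule span_scale)
  then show "y \<in> span F" using e by simp
qed

lemma subspace_ball_subset_tangent_lineality:
  fixes L :: "'a::euclidean_space set"
  assumes L: "subspace L" "x \<in> L" and r: "0 < r" "ball x r \<inter> L \<subseteq> C"
  shows "L \<subseteq> tangent_lineality C x"
proof
  fix y assume y: "y \<in> L"
  obtain e where e: "0 < e" "x + e *\<^sub>R y \<in> ball x r" "x - e *\<^sub>R y \<in> ball x r"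
    using short_segment_in_ball[OF r(1)] .
  have "x + e *\<^sub>R y \<in> L" "x - e *\<^sub>R y \<in> L"
    using y L by (auto simp: subspace_add subspace_diff subspace_scale)
  then show "y \<in> tangent_lineality C x"
    using e r unfolding tangent_lineality_def by blast
qed

text \<open>The relatively open faces are the fibres of \<open>tangent_lineality C\<close>; in particular they are disjoint and
cover \<open>C\<close>.\<close>

lemma relative_interior_face_span:
  fixes C :: "(real ^ 'n) set"
  assumes C: "C \<in> polyhedral_cones" and L: "L \<in> face_spans k C"
  shows "(top_of_set L) interior_of (C \<inter> L) = {x \<in> C. tangent_lineality C x = L}"
proof -
  obtain F where F: "F \<in> cone_faces C" "L = span F" using L unfolding face_spans_def by blast
  have Ls: "subspace L" using F by simp
  have CL: "C \<inter> L = F" using cone_face_Int_span[OF F(1)] F(2) by simp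
  show ?thesis
  proof (intro subset_antisym subsetI)
    fix x assume "x \<in> (top_of_set L) interior_of (C \<inter> L)"
    then obtain T where T: "openin (top_of_set L) T" "x \<in> T" "T \<subseteq> C \<inter> L"
      unfolding interior_of_def by blast
    then obtain r where r: "0 < r" "ball x r \<inter> L \<subseteq> T" using openin_contains_ball by metis
    then have "L \<subseteq> tangent_lineality C x"
      using T Ls by (intro subspace_ball_subset_tangent_lineality[of L x r C]) auto
    moreover have "tangent_lineality C x \<subseteq> L"
      using tangent_lineality_subset_face_span[OF F(1)] T CL F(2) by blast
    ultimately show "x \<in> {x \<in> C. tangent_lineality C x = L}" using T by auto
  next
    fix x assume "x \<in> {x \<in> C. tangent_lineality C x = L}"
    then have x: "x \<in> C" "tangent_lineality C x = L" by auto
    obtain r where r: "0 < r" "ball x r \<inter> L \<subseteq> C"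
      using ball_Int_tangent_lineality_subset[OF C x(1)] x(2) by auto
    have "x \<in> L" using mem_tangent_lineality[OF C x(1)] x(2) by simp
    moreover have "openin (top_of_set L) (L \<inter> ball x r)" by (simp add: openin_open_Int)
    ultimately show "x \<in> (top_of_set L) interior_of (C \<inter> L)"
      unfolding interior_of_def using r by (intro CollectI exI[of _ "L \<inter> ball x r"]) auto
  qed
qed

lemma skeleton_eq:
  fixes C :: "(real ^ 'n) set"
  assumes C: "C \<in> polyhedral_cones"
  shows "skeleton k C = {x \<in> C. dim (tangent_lineality C x) = k}"
proof (intro subset_antisym subsetI)
  fix x assume "x \<in> skeleton k C"
  then obtain L where L: "L \<in> face_spans k C" "x \<in> (top_of_set L) interior_of (C \<inter> L)"
    unfolding skeleton_def by blast
  then have "x \<in> {x \<in> C. tangent_lineality C x = L}"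
    using relative_interior_face_span[OF C] by blast
  then show "x \<in> {x \<in> C. dim (tangent_lineality C x) = k}"
    using L(1) unfolding face_spans_def by auto
next
  fix x assume "x \<in> {x \<in> C. dim (tangent_lineality C x) = k}"
  then have x: "x \<in> C" "dim (tangent_lineality C x) = k" by auto
  have L: "tangent_lineality C x \<in> face_spans k C"
    using tangent_lineality_face_span[OF C x(1)] x(2) by simp
  have "x \<in> (top_of_set (tangent_lineality C x)) interior_of (C \<inter> tangent_lineality C x)"
    using relative_interior_face_span[OF C L] x(1) by simp
  then show "x \<in> skeleton k C" using L unfolding skeleton_def by blast
qed

text \<open>Any relative interior point of a face will do.\<close>

lemma face_span_attained:
  fixes C :: "(real ^ 'n) set"
  assumes C: "C \<in> polyhedral_cones" and L: "L \<in> face_spans k C"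
  obtains x where "x \<in> C" "tangent_lineality C x = L"
proof -
  obtain F where F: "F \<in> cone_faces C" "L = span F" using L unfolding face_spans_def by blast
  have CL: "C \<inter> L = F" using cone_face_Int_span[OF F(1)] F(2) by simp
  have Ls: "subspace L" using F by simp
  have 0: "0 \<in> F" using CL polyhedral_cones_zero[OF C] subspace_0[OF Ls] by blast
  \<comment> \<open>A face contains the origin, so its affine hull is its span and its relative interior is
    taken in \<open>L\<close>.\<close>
  have "convex F"
    using CL polyhedral_cones_convex[OF C] subspace_imp_convex[OF Ls] by (metis convex_Int)
  then obtain x where x: "x \<in> rel_interior F" using 0 rel_interior_eq_empty by blast
  have hull: "affine hull F = L" using affine_hull_span_0 hull_inc[OF 0, of affine] F(2) by blast
  obtain e where e: "x \<in> F" "0 < e" "ball x e \<inter> L \<subseteq> F"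
    using x hull unfolding mem_rel_interior_ball by blast
  have "L \<subseteq> tangent_lineality C x"
    using e CL Ls by (intro subspace_ball_subset_tangent_lineality[of L x e C]) auto
  moreover have "tangent_lineality C x \<subseteq> L"
    using tangent_lineality_subset_face_span[OF F(1) e(1)] F(2) by simp
  ultimately show ?thesis using that e CL by blast
qed

lemma face_spans_eq:
  fixes C :: "(real ^ 'n) set"
  assumes C: "C \<in> polyhedral_cones"
  shows "face_spans k C = {L \<in> tangent_lineality C ` C. dim L = k}"
proof (intro subset_antisym subsetI)
  fix L assume L: "L \<in> face_spans k C"
  then obtain x where "x \<in> C" "tangent_lineality C x = L" by (rule face_span_attained[OF C])
  then show "L \<in> {L \<in> tangent_lineality C ` C. dim L = k}"
    using L unfolding face_spans_def by auto
qed (use tangent_lineality_face_span[OF C] in auto)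

definition open_face :: "(real ^ 'n) set \<Rightarrow> (real ^ 'n) set \<Rightarrow> (real ^ 'n) set" where
  "open_face C L = {x \<in> C. tangent_lineality C x = L}"

lemma open_face_conic:
  fixes C :: "(real ^ 'n) set"
  assumes C: "C \<in> polyhedral_cones" and L: "L \<in> face_spans k C"
  shows "open_face C L \<in> conic_sets"
  unfolding conic_sets_iff
proof (intro conjI allI impI ballI)
  have "closed L" using L unfolding face_spans_def by (auto intro: closed_subspace)
  obtain U where "open U" "(top_of_set L) interior_of (C \<inter> L) = L \<inter> U"
    using openin_interior_of[of "top_of_set L" "C \<inter> L"] unfolding openin_open by blast
  then show "open_face C L \<in> sets borel"
    using \<open>closed L\<close> relative_interior_face_span[OF C L] by (simp add: open_face_def)
  show "c *\<^sub>R x \<in> open_face C L" if "0 < c" "x \<in> open_face C L" for c x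
    using that tangent_lineality_scale[OF C _ that(1)] polyhedral_cones_scale[OF C]
    by (simp add: open_face_def)
qed

lemma open_face_subset:
  fixes C :: "(real ^ 'n) set"
  assumes C: "C \<in> polyhedral_cones"
  shows "open_face C L \<subseteq> C \<inter> L"
  using mem_tangent_lineality[OF C] by (auto simp: open_face_def)

text \<open>A point of \<open>C \<inter> L\<close> outside the open face lies in its own tangent lineality space, which is one of finitely many
proper subspaces of \<open>L\<close>.\<close>

lemma open_face_AE:
  fixes C :: "(real ^ 'n) set"
  assumes C: "C \<in> polyhedral_cones" and L: "L \<in> face_spans k C"
  shows "AE x in subspace_gaussian L. x \<in> C \<inter> L \<longleftrightarrow> x \<in> open_face C L"
proof -
  obtain F where F: "F \<in> cone_faces C" "L = span F" using L unfolding face_spans_def by blast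
  have CL: "C \<inter> L = F" using cone_face_Int_span[OF F(1)] F(2) by simp
  have Ls: "subspace L" using F by simp
  let ?H = "{H \<in> tangent_lineality C ` C. H \<subset> L}"
  have "finite ?H"
  proof (rule finite_subset)
    show "?H \<subseteq> (\<Union>k\<le>CARD('n). face_spans k C)"
      using dim_subset_UNIV_cart by (auto simp: face_spans_eq[OF C])
    show "finite (\<Union>k\<le>CARD('n). face_spans k C)" using finite_face_spans[OF C] by simp
  qed
  moreover have "H \<in> null_sets (subspace_gaussian L)" if "H \<in> ?H" for H
    using that subspace_tangent_lineality[OF C] by (intro subspace_gaussian_null Ls) auto
  ultimately have "\<Union> ?H \<in> null_sets (subspace_gaussian L)"
    using null_sets_UN'[of ?H "\<lambda>H. H"] by (simp add: countable_finite)
  then have "AE x in subspace_gaussian L. x \<notin> \<Union> ?H" by (rule AE_not_in)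
  then show ?thesis
  proof eventually_elim
    fix x assume x: "x \<notin> \<Union> ?H"
    have "tangent_lineality C x = L" if "x \<in> C \<inter> L"
      using tangent_lineality_subset_face_span[OF F(1), of x] mem_tangent_lineality[OF C, of x]
        that x CL F(2) by blast
    then show "x \<in> C \<inter> L \<longleftrightarrow> x \<in> open_face C L"
      using open_face_subset[OF C, of L] by (auto simp: open_face_def)
  qed
qed

text \<open>The inequalities say that the coordinates along an orthonormal basis of the orthogonal complement are
nonpositive and nonnegative.\<close>

lemma subspace_polyhedral:
  fixes L :: "(real ^ 'n) set"
  assumes L: "subspace L"
  shows "L \<in> polyhedral_cones"
proof -
  obtain B where B: "orthonormal B" "span B = L"
    using orthonormal_basis_subspace[OF L] unfolding orthonormal_def by metis
  obtain B' where B': "B \<subseteq> B'" "orthonormal B'" "span B' = UNIV"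
    using orthonormal_extend[OF B(1)] .
  have fin: "finite B'" by (rule orthonormal_finite[OF B'(2)])
  then obtain xs where xs: "set xs = (B' - B) \<union> uminus ` (B' - B)"
    using finite_list[of "(B' - B) \<union> uminus ` (B' - B)"] by blast
  have "x \<in> L \<longleftrightarrow> (\<forall>b\<in>B' - B. b \<bullet> x = 0)" for x
  proof
    assume "x \<in> L"
    show "\<forall>b\<in>B' - B. b \<bullet> x = 0"
    proof
      fix b assume b: "b \<in> B' - B"
      have "L \<subseteq> {x. b \<bullet> x = 0}"
        unfolding B(2)[symmetric]
        by (rule span_minimal)
          (use b B'(1) orthonormal_inner[OF B'(2), of b] in \<open>auto simp: subspace_hyperplane\<close>)
      then show "b \<bullet> x = 0" using \<open>x \<in> L\<close> by blast
    qed
  next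
    assume x: "\<forall>b\<in>B' - B. b \<bullet> x = 0"
    have "x = (\<Sum>b\<in>B'. (x \<bullet> b) *\<^sub>R b)"
      using B' fin by (intro orthonormal_basis_expand[symmetric]) (auto simp: orthonormal_def)
    also have "\<dots> = (\<Sum>b\<in>B. (x \<bullet> b) *\<^sub>R b)"
      using x B' fin by (intro sum.mono_neutral_right) (auto simp: inner_commute)
    also have "\<dots> \<in> L" unfolding B(2)[symmetric] by (intro span_sum span_scale span_base)
    finally show "x \<in> L" .
  qed
  moreover have "(\<forall>b\<in>B' - B. b \<bullet> x = 0) \<longleftrightarrow> (\<forall>b\<in>set xs. b \<bullet> x \<le> 0)" for x
    unfolding xs ball_Un ball_simps by (auto simp: inner_minus_left order_eq_iff)
  ultimately have "L = {x. \<forall>i<length xs. xs ! i \<bullet> x \<le> 0}"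
    by (auto simp: all_set_conv_all_nth)
  then show ?thesis unfolding polyhedral_cones_def by blast
qed

lemma tangent_lineality_of_subspace:
  assumes L: "subspace L" and x: "x \<in> L"
  shows "tangent_lineality L x = L"
proof (intro subset_antisym subsetI)
  fix y assume "y \<in> tangent_lineality L x"
  then obtain e where e: "0 < e" "x + e *\<^sub>R y \<in> L" unfolding tangent_lineality_def by blast
  have "(1 / e) *\<^sub>R ((x + e *\<^sub>R y) - x) \<in> L"
    using L x e by (intro subspace_scale subspace_diff)
  then show "y \<in> L" using e by simp
next
  fix y assume "y \<in> L"
  then show "y \<in> tangent_lineality L x"
    unfolding tangent_lineality_def using L x
    by (auto intro!: exI[of _ 1] simp: subspace_add subspace_diff)
qed

lemma tangent_lineality_0:
  fixes C :: "(real ^ 'n) set"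
  assumes C: "C \<in> polyhedral_cones"
  shows "tangent_lineality C 0 = C \<inter> uminus ` C"
proof (intro subset_antisym subsetI)
  fix y assume "y \<in> tangent_lineality C 0"
  then obtain e where e: "0 < e" "e *\<^sub>R y \<in> C" "e *\<^sub>R (- y) \<in> C"
    unfolding tangent_lineality_def by auto
  then have "y \<in> C" "- y \<in> C"
    using conic_sets_scale[OF polyhedral_cones_conic[OF C] e(1)] by blast+
  then show "y \<in> C \<inter> uminus ` C" by (metis IntI image_eqI minus_minus)
next
  fix y assume "y \<in> C \<inter> uminus ` C"
  then show "y \<in> tangent_lineality C 0"
    unfolding tangent_lineality_def by (auto intro!: exI[of _ 1])
qed

section \<open>The representation\<close>

lemma disjoint_open_faces:
  "L \<noteq> L' \<Longrightarrow> open_face C L \<inter> open_face C L' = {}"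
  by (auto simp: open_face_def)

lemma measure_open_face:
  fixes C :: "(real ^ 'n) set"
  assumes C: "C \<in> polyhedral_cones" and L: "L \<in> face_spans k C" "k \<noteq> 0" and M: "M \<in> conic_sets"
  shows "measure (subspace_gaussian L) ((M - {0}) \<inter> open_face C L) =
    measure (subspace_gaussian L) (C \<inter> L \<inter> M)"
proof (rule measure_eq_AE)
  have Ls: "subspace L" "dim L \<noteq> 0" using L unfolding face_spans_def by auto
  have "\<not> L \<subseteq> {0}" using Ls(2) by (simp add: dim_eq_0)
  then have "{0} \<in> null_sets (subspace_gaussian L)"
    by (intro subspace_gaussian_null Ls subspace_single_0)
  then have "AE x in subspace_gaussian L. x \<noteq> 0" by (auto dest: AE_not_in)
  then show "AE x in subspace_gaussian L. x \<in> (M - {0}) \<inter> open_face C L \<longleftrightarrow> x \<in> C \<inter> L \<inter> M"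
    using open_face_AE[OF C L(1)] by eventually_elim blast
  have "(M - {0}) \<inter> open_face C L \<in> conic_sets"
    by (intro conic_sets_Int conic_sets_Diff conic_sets_singleton open_face_conic[OF C L(1)] M)
  then show "(M - {0}) \<inter> open_face C L \<in> sets (subspace_gaussian L)"
    using Ls by (simp add: conic_sets_iff)
  have "C \<inter> L \<inter> M \<in> conic_sets"
    by (intro conic_sets_Int conic_sets_subspace Ls polyhedral_cones_conic[OF C] M)
  then show "C \<inter> L \<inter> M \<in> sets (subspace_gaussian L)"
    using Ls by (simp add: conic_sets_iff)
qed

text \<open>The four properties that force \<open>\<psi>\<close> to be a combination of lineality and polyhedral measures.\<close>

locale local_conic_functional =
  fixes \<psi> :: "(real ^ 'n) set \<Rightarrow> (real ^ 'n) set \<Rightarrow> real"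
  assumes conic: "C \<in> polyhedral_cones \<Longrightarrow> conic_measure (\<psi> C)"
    and concentrated: "C \<in> polyhedral_cones \<Longrightarrow> M \<in> conic_sets \<Longrightarrow> \<psi> C M = \<psi> C (M \<inter> C)"
    and invariant: "C \<in> polyhedral_cones \<Longrightarrow> M \<in> conic_sets \<Longrightarrow> orthogonal_transformation Q \<Longrightarrow>
      \<psi> (Q ` C) (Q ` M) = \<psi> C M"
    and locality: "C \<in> polyhedral_cones \<Longrightarrow> D \<in> polyhedral_cones \<Longrightarrow> M \<in> conic_sets \<Longrightarrow>
      (\<forall>k\<le>CARD('n). skeleton k C \<inter> M = skeleton k D \<inter> M) \<Longrightarrow> \<psi> C M = \<psi> D M"
begin

lemma signed: "C \<in> polyhedral_cones \<Longrightarrow> countably_additive_signed conic_algebra (\<psi> C)"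
  using conic by (simp add: conic_measure_signed)

lemma subspace_value_cong:
  assumes "subspace L" "subspace L'" "dim L = dim L'" and M: "M \<in> conic_sets"
    and QM: "\<And>Q. orthogonal_transformation Q \<Longrightarrow> Q ` M = M"
  shows "\<psi> L M = \<psi> L' M"
proof -
  obtain Q where Q: "orthogonal_transformation Q" "Q ` L = L'"
    using orthogonal_transformation_between_subspaces[OF assms(1-3)] .
  then show ?thesis
    using invariant[OF subspace_polyhedral[OF assms(1)] M Q(1)] QM[OF Q(1)] by simp
qed

text \<open>A skeleton of \<open>C\<close> contains the origin exactly if its index is the dimension of the lineality space, and
the same holds for the lineality space itself.\<close>

lemma value_at_origin:
  assumes C: "C \<in> polyhedral_cones"
  shows "\<psi> C {0} = \<psi> (C \<inter> uminus ` C) {0}"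
proof (rule locality[OF C subspace_polyhedral conic_sets_singleton])
  have 0: "0 \<in> C" by (rule polyhedral_cones_zero[OF C])
  show s: "subspace (C \<inter> uminus ` C)"
    using subspace_tangent_lineality[OF C 0] by (simp add: tangent_lineality_0[OF C])
  show "\<forall>k\<le>CARD('n). skeleton k C \<inter> {0} = skeleton k (C \<inter> uminus ` C) \<inter> {0}"
    using tangent_lineality_of_subspace[OF s subspace_0[OF s]] 0 subspace_0[OF s]
    by (auto simp: skeleton_eq[OF C] skeleton_eq[OF subspace_polyhedral[OF s]] tangent_lineality_0[OF C])
qed

text \<open>On the open face all points of \<open>C\<close> and of \<open>L\<close> have the same tangent lineality space \<open>L\<close>, so locality
exchanges the two cones, and invariance under the rotations of \<open>L\<close> determines \<open>\<psi> L\<close>. For \<open>k = 0\<close>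
the open face is at most the origin, which \<open>M\<close> misses.\<close>

lemma value_on_open_face:
  assumes C: "C \<in> polyhedral_cones" and L: "L \<in> face_spans k C"
    and M: "M \<in> conic_sets" "0 \<notin> M" "M \<subseteq> open_face C L"
  shows "\<psi> C M = (if k = 0 then 0 else \<psi> L (UNIV - {0}) * measure (subspace_gaussian L) M)"
proof (cases "k = 0")
  case True
  then have "L \<subseteq> {0}" using L unfolding face_spans_def by auto
  then have "M = {}" using M open_face_subset[OF C, of L] by blast
  then show ?thesis using True signed_empty[OF signed[OF C]] by simp
next
  case False
  have Ls: "subspace L" "dim L \<noteq> 0" using L False unfolding face_spans_def by auto
  have LP: "L \<in> polyhedral_cones" by (rule subspace_polyhedral[OF Ls(1)])
  have sub: "M \<subseteq> L" using M(3) open_face_subset[OF C, of L] by blast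
  have "\<psi> C M = \<psi> L M"
  proof (rule locality[OF C LP M(1)], intro allI impI)
    fix j
    have "x \<in> C" "x \<in> L" "tangent_lineality C x = tangent_lineality L x" if "x \<in> M" for x
    proof -
      show "x \<in> L" using that sub by blast
      moreover have "x \<in> open_face C L" using that M(3) by blast
      ultimately show "x \<in> C" "tangent_lineality C x = tangent_lineality L x"
        using tangent_lineality_of_subspace[OF Ls(1)] by (simp_all add: open_face_def)
    qed
    then show "skeleton j C \<inter> M = skeleton j L \<inter> M"
      unfolding skeleton_eq[OF C] skeleton_eq[OF LP]
      by auto
  qed
  also have "\<dots> = \<psi> L (UNIV - {0}) * measure (subspace_gaussian L) M"
  proof (rule invariant_conic_measure[OF conic[OF LP] Ls concentrated[OF LP] _ M(1,2)])
    show "\<psi> L (Q ` M) = \<psi> L M" if "orthogonal_transformation Q" "Q ` L = L" "M \<in> conic_sets" for Q M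
      using invariant[OF LP that(3,1)] that(2) by simp
  qed
  finally show ?thesis using False by simp
qed

text \<open>Additivity over the open faces, grouped by dimension. By \<open>measure_open_face\<close> each open face may be replaced by
\<open>C \<inter> L\<close> under the Gaussian measure, and rotating \<open>L\<close> to \<open>N k\<close> shows that the coefficient depends only on \<open>k\<close>.\<close>

lemma value_off_origin:
  assumes C: "C \<in> polyhedral_cones" and M: "M \<in> conic_sets"
    and N: "\<And>k. k \<le> CARD('n) \<Longrightarrow> subspace (N k) \<and> dim (N k) = k"
  shows "\<psi> C (M - {0}) = (\<Sum>k=1..CARD('n). \<psi> (N k) (UNIV - {0}) * polyhedral_measure k C M)"
proof -
  let ?T = "tangent_lineality C ` C" and ?M = "M - {0}"
  have M0: "?M \<in> conic_sets" by (intro conic_sets_Diff conic_sets_singleton M)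
  have dimT: "dim L \<le> CARD('n)" for L :: "(real ^ 'n) set" by (rule dim_subset_UNIV_cart)
  have fs: "L \<in> face_spans (dim L) C" if "L \<in> ?T" for L
    using that by (simp add: face_spans_eq[OF C])
  have fin: "finite ?T"
  proof (rule finite_subset)
    show "?T \<subseteq> (\<Union>k\<le>CARD('n). face_spans k C)" using dimT fs by blast
    show "finite (\<Union>k\<le>CARD('n). face_spans k C)" using finite_face_spans[OF C] by simp
  qed
  have conic': "?M \<inter> open_face C L \<in> conic_sets" if "L \<in> ?T" for L
    by (intro conic_sets_Int M0 open_face_conic[OF C fs[OF that]])
  define h where "h L = (if dim L = 0 then 0 else
    \<psi> L (UNIV - {0}) * measure (subspace_gaussian L) (C \<inter> L \<inter> M))" for L
  have h: "\<psi> C (?M \<inter> open_face C L) = h L" if "L \<in> ?T" for L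
    using value_on_open_face[OF C fs[OF that] conic'[OF that]] measure_open_face[OF C fs[OF that] _ M]
    by (auto simp: h_def)
  have "\<psi> C ?M = \<psi> C (?M \<inter> C)" by (rule concentrated[OF C M0])
  also have "?M \<inter> C = (\<Union>L\<in>?T. ?M \<inter> open_face C L)"
    by (auto simp: open_face_def)
  also have "\<psi> C \<dots> = (\<Sum>L\<in>?T. \<psi> C (?M \<inter> open_face C L))"
  proof (rule signed_finite_UN[OF signed[OF C] fin])
    show "disjoint_family_on (\<lambda>L. ?M \<inter> open_face C L) ?T"
      using disjoint_open_faces unfolding disjoint_family_on_def by blast
  qed (use conic' in \<open>simp add: sets_conic_algebra\<close>)
  also have "\<dots> = (\<Sum>L\<in>?T. h L)" by (intro sum.cong h refl)
  also have "\<dots> = (\<Sum>k\<in>{0..CARD('n)}. \<Sum>L\<in>{L \<in> ?T. dim L = k}. h L)"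
    by (rule sum.group[symmetric]) (use fin dimT in auto)
  also have "\<dots> = (\<Sum>k=0..CARD('n). \<Sum>L\<in>face_spans k C. h L)"
    by (simp only: face_spans_eq[OF C])
  also have "\<dots> = (\<Sum>k=1..CARD('n). \<Sum>L\<in>face_spans k C. h L)"
  proof (rule sum.mono_neutral_right)
    show "\<forall>k\<in>{0..CARD('n)} - {1..CARD('n)}. (\<Sum>L\<in>face_spans k C. h L) = 0"
    proof
      fix k assume "k \<in> {0..CARD('n)} - {1..CARD('n)}"
      then have "k = 0" by auto
      then show "(\<Sum>L\<in>face_spans k C. h L) = 0"
        by (intro sum.neutral) (auto simp: h_def face_spans_def)
    qed
  qed auto
  also have "\<dots> = (\<Sum>k=1..CARD('n). \<psi> (N k) (UNIV - {0}) * polyhedral_measure k C M)"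
  proof (rule sum.cong[OF refl])
    fix k assume k: "k \<in> {1..CARD('n)}"
    have "h L = \<psi> (N k) (UNIV - {0}) * measure (subspace_gaussian L) (C \<inter> L \<inter> M)"
      if L: "L \<in> face_spans k C" for L
    proof -
      have dL: "subspace L" "dim L = k" using L unfolding face_spans_def by auto
      have "\<psi> L (UNIV - {0}) = \<psi> (N k) (UNIV - {0})"
      proof (rule subspace_value_cong)
        show "UNIV - {0} \<in> (conic_sets :: (real ^ 'n) set set)"
          by (intro conic_sets_Diff conic_sets_singleton conic_sets_UNIV)
        show "Q ` (UNIV - {0}) = UNIV - {0}" if Q: "orthogonal_transformation Q"
          for Q :: "real ^ 'n \<Rightarrow> real ^ 'n"
          using orthogonal_transformation_bij[OF Q] linear_0[OF orthogonal_transformation_linear[OF Q]]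
          by (simp add: image_set_diff bij_is_inj bij_is_surj)
      qed (use dL N k in auto)
      then show ?thesis using dL k by (simp add: h_def)
    qed
    then show "(\<Sum>L\<in>face_spans k C. h L) = \<psi> (N k) (UNIV - {0}) * polyhedral_measure k C M"
      by (simp add: polyhedral_measure_def sum_distrib_left)
  qed
  finally show ?thesis .
qed

lemma representation:
  assumes C: "C \<in> polyhedral_cones" and M: "M \<in> conic_sets"
    and N: "\<And>k. k \<le> CARD('n) \<Longrightarrow> subspace (N k) \<and> dim (N k) = k"
  shows "\<psi> C M = (\<Sum>k=0..CARD('n). \<psi> (N k) {0} * lineality_measure k C M)
    + (\<Sum>k=1..CARD('n). \<psi> (N k) (UNIV - {0}) * polyhedral_measure k C M)"
proof -
  let ?V = "C \<inter> uminus ` C"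
  have V: "subspace ?V"
    using subspace_tangent_lineality[OF C polyhedral_cones_zero[OF C]]
    by (simp add: tangent_lineality_0[OF C])
  have dV: "dim ?V \<le> CARD('n)" by (rule dim_subset_UNIV_cart)
  have "\<psi> C M = \<psi> C (M \<inter> {0}) + \<psi> C (M - {0})"
    using signed_Un[OF signed[OF C], unfolded sets_conic_algebra,
        OF conic_sets_Int[OF M conic_sets_singleton] conic_sets_Diff[OF M conic_sets_singleton]]
    by (simp only: Int_Diff_Un) blast
  also have "\<psi> C (M \<inter> {0}) = (\<Sum>k=0..CARD('n). \<psi> (N k) {0} * lineality_measure k C M)"
  proof (cases "0 \<in> M")
    case True
    have "\<psi> C (M \<inter> {0}) = \<psi> ?V {0}" using True value_at_origin[OF C] by simp
    also have "\<dots> = \<psi> (N (dim ?V)) {0}"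
    proof (rule subspace_value_cong[OF V _ _ conic_sets_singleton])
      show "Q ` {0} = {0}" if Q: "orthogonal_transformation Q" for Q :: "real ^ 'n \<Rightarrow> real ^ 'n"
        using linear_0[OF orthogonal_transformation_linear[OF Q]] by simp
    qed (use N[OF dV] in auto)
    also have "\<dots> = (\<Sum>k=0..CARD('n). if dim ?V = k then \<psi> (N k) {0} else 0)"
      using dV by (simp add: sum.delta')
    also have "\<dots> = (\<Sum>k=0..CARD('n). \<psi> (N k) {0} * lineality_measure k C M)"
      using True by (intro sum.cong) (auto simp: lineality_measure_def)
    finally show ?thesis .
  next
    case False
    then show ?thesis
      using signed_empty[OF signed[OF C]] by (simp add: lineality_measure_def)
  qed
  also note value_off_origin[OF C M N]
  finally show ?thesis by simp
qed

end

text \<open>The origin spans a face of \<open>C\<close> exactly if \<open>C\<close> contains no line, and the Gaussian measure on the zero space is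
the Dirac measure.\<close>

lemma lineality_measure_0_eq_polyhedral_measure_0:
  fixes C :: "(real ^ 'n) set"
  assumes C: "C \<in> polyhedral_cones" and M: "M \<in> conic_sets"
  shows "lineality_measure 0 C M = polyhedral_measure 0 C M"
proof -
  let ?V = "C \<inter> uminus ` C"
  have 0: "0 \<in> C" by (rule polyhedral_cones_zero[OF C])
  have zero: "L = {0}" if "subspace L" "dim L = 0" for L :: "(real ^ 'n) set"
    using that subspace_0[OF that(1)] by auto
  have V: "tangent_lineality C 0 = ?V" "subspace ?V"
    using subspace_tangent_lineality[OF C 0] by (simp_all add: tangent_lineality_0[OF C])
  have Z: "measure (subspace_gaussian {0 :: real ^ 'n}) (C \<inter> {0} \<inter> M) = (if 0 \<in> M then 1 else 0)"
  proof (cases "0 \<in> M")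
    case True
    interpret G: prob_space "subspace_gaussian {0 :: real ^ 'n}"
      by (rule prob_space_subspace_gaussian[OF subspace_single_0])
    have "AE x in subspace_gaussian {0 :: real ^ 'n}. x \<in> {0}"
      by (rule subspace_gaussian_concentrated[OF subspace_single_0])
    then have "G.prob {0} = 1"
      by (intro G.prob_eq_1[THEN iffD2]) (simp_all add: subspace_single_0)
    then show ?thesis using True 0 by (simp add: Int_absorb2 Int_absorb1 insert_absorb)
  next
    case False
    then have "C \<inter> {0} \<inter> M = {}" by auto
    then show ?thesis using False by simp
  qed
  show ?thesis
  proof (cases "dim ?V = 0")
    case True
    have "face_spans 0 C = {{0}}"
    proof
      show "face_spans 0 C \<subseteq> {{0}}" using zero by (auto simp: face_spans_def)
      have "?V \<in> face_spans 0 C" using 0 V True by (auto simp: face_spans_eq[OF C])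
      then show "{{0}} \<subseteq> face_spans 0 C" using zero[OF V(2) True] by simp
    qed
    then show ?thesis using True Z by (simp add: lineality_measure_def polyhedral_measure_def)
  next
    case False
    have "face_spans 0 C = {}"
    proof (rule ccontr)
      assume "face_spans 0 C \<noteq> {}"
      then obtain L where L: "L \<in> face_spans 0 C" by blast
      obtain x where x: "x \<in> C" "tangent_lineality C x = L" using face_span_attained[OF C L] .
      have L0: "L = {0}" using zero L unfolding face_spans_def by blast
      then have "x = 0" using mem_tangent_lineality[OF C x(1)] x(2) by blast
      then show False using V(1) x(2) L0 False by simp
    qed
    then show ?thesis using False by (simp add: lineality_measure_def polyhedral_measure_def)
  qed
qed

theorem theorem2p7:
  fixes \<psi> :: "(real ^ 'n) set \<Rightarrow> (real ^ 'n) set \<Rightarrow> real"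
  assumes "\<And>C. C \<in> polyhedral_cones \<Longrightarrow> conic_measure (\<psi> C)"
    and "\<And>C M. C \<in> polyhedral_cones \<Longrightarrow> M \<in> conic_sets \<Longrightarrow> \<psi> C M = \<psi> C (M \<inter> C)"
    and "\<And>C M Q. C \<in> polyhedral_cones \<Longrightarrow> M \<in> conic_sets \<Longrightarrow> orthogonal_transformation Q \<Longrightarrow>
           \<psi> (Q ` C) (Q ` M) = \<psi> C M"
    and "\<And>C D M. C \<in> polyhedral_cones \<Longrightarrow> D \<in> polyhedral_cones \<Longrightarrow> M \<in> conic_sets \<Longrightarrow>
           (\<forall>k\<le>CARD('n). skeleton k C \<inter> M = skeleton k D \<inter> M) \<Longrightarrow> \<psi> C M = \<psi> D M"
  shows "(\<forall>C\<in>polyhedral_cones. \<forall>M\<in>conic_sets.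
            lineality_measure 0 C M = polyhedral_measure 0 (C :: (real ^ 'n) set) M) \<and>
         (\<exists>a b :: nat \<Rightarrow> real. \<forall>C\<in>polyhedral_cones. \<forall>M\<in>conic_sets.
            \<psi> C M = (\<Sum>k=0..CARD('n). a k * lineality_measure k C M)
                  + (\<Sum>k=1..CARD('n). b k * polyhedral_measure k C M)) \<and>
         (\<forall>L :: nat \<Rightarrow> (real ^ 'n) set. (\<forall>k\<le>CARD('n). subspace (L k) \<and> dim (L k) = k) \<longrightarrow>
            (\<forall>C\<in>polyhedral_cones. \<forall>M\<in>conic_sets.
               \<psi> C M = (\<Sum>k=0..CARD('n). \<psi> (L k) {0} * lineality_measure k C M)
                     + (\<Sum>k=1..CARD('n). \<psi> (L k) (UNIV - {0}) * polyhedral_measure k C M)))"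
proof -
  interpret local_conic_functional \<psi>
    by unfold_locales (fact assms)+
  have "\<exists>N :: (real ^ 'n) set. subspace N \<and> dim N = k" if "k \<le> CARD('n)" for k
    using choose_subspace_of_subspace[of k "UNIV :: (real ^ 'n) set"] that
    by (metis DIM_cart DIM_real dim_UNIV mult.right_neutral)
  then obtain N :: "nat \<Rightarrow> (real ^ 'n) set" where
    N: "\<And>k. k \<le> CARD('n) \<Longrightarrow> subspace (N k) \<and> dim (N k) = k"
    by metis
  show ?thesis
  proof (intro conjI)
    show "\<forall>C\<in>polyhedral_cones. \<forall>M\<in>conic_sets.
        lineality_measure 0 C M = polyhedral_measure 0 (C :: (real ^ 'n) set) M"
      using lineality_measure_0_eq_polyhedral_measure_0 by blast
    show "\<exists>a b :: nat \<Rightarrow> real. \<forall>C\<in>polyhedral_cones. \<forall>M\<in>conic_sets.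
        \<psi> C M = (\<Sum>k=0..CARD('n). a k * lineality_measure k C M)
              + (\<Sum>k=1..CARD('n). b k * polyhedral_measure k C M)"
      by (rule exI[of _ "\<lambda>k. \<psi> (N k) {0}"], rule exI[of _ "\<lambda>k. \<psi> (N k) (UNIV - {0})"])
        (intro ballI representation N)
    show "\<forall>L :: nat \<Rightarrow> (real ^ 'n) set. (\<forall>k\<le>CARD('n). subspace (L k) \<and> dim (L k) = k) \<longrightarrow>
        (\<forall>C\<in>polyhedral_cones. \<forall>M\<in>conic_sets.
           \<psi> C M = (\<Sum>k=0..CARD('n). \<psi> (L k) {0} * lineality_measure k C M)
                 + (\<Sum>k=1..CARD('n). \<psi> (L k) (UNIV - {0}) * polyhedral_measure k C M))"
      by (intro allI impI ballI representation) auto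
  qed
qed

end
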